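(* Let $\phi = \forall x_1 \cdots \forall x_k \exists y_1 \cdots \exists y_l\, \theta$ be an $\mathcal{L}$-sentence with $\theta$ quantifier-free, and suppose that $\sigma:\mathbf{Var}(\phi)\to\mathbb{N}$ is a stratification of $\phi$ that assigns distinct values to all of the variables $y_1,\ldots,y_l$. Then $\mathrm{NF}$ decides $\phi$, i.e. $\mathrm{NF}\vdash\phi$ or $\mathrm{NF}\vdash\neg\phi$.
   Context: $\mathcal{L}$ is the (single-sorted) first-order language of set theory with equality and one binary relation symbol $\in$. For an $\mathcal{L}$-formula $\phi$, $\mathbf{Var}(\phi)$ is the set of all variables (free and bound) appearing in $\phi$. A stratification of $\phi$ is a function $\sigma:\mathbf{Var}(\phi)\to\mathbb{N}$ such that (i) if $x\in y$ is a subformula of $\phi$ then $\sigma(y)=\sigma(x)+1$, and (ii) if $x=y$ is a subformula of $\phi$ then $\sigma(y)=\sigma(x)$. A formula is stratified if it has a stratification. $\mathrm{NF}$ is the $\mathcal{L}$-theory with axioms: (Extensionality) $\forall x\forall y(x=y\iff\forall z(z\in x\iff z\in y))$; (Stratified Comprehension) $\forall\vec z\,\exists y\,\forall x(x\in y\iff\varphi(x,\vec z))$ for every stratified $\varphi(x,\vec z)$. *)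

theory Defs
  imports Main
begin

type_synonym var = nat

text \<open>Formulas of the first-order language of set theory. The remaining connectives and the
  existential quantifier are the usual abbreviations; they add no variables and no atomic
  subformulas, so they do not affect stratification.\<close>

datatype fm =
    Mem var var
  | Eq var var
  | Neg fm
  | Imp fm fm
  | Forall var fm

abbreviation Conj :: "fm \<Rightarrow> fm \<Rightarrow> fm" where
  "Conj p q \<equiv> Neg (Imp p (Neg q))"

abbreviation Iff :: "fm \<Rightarrow> fm \<Rightarrow> fm" where
  "Iff p q \<equiv> Conj (Imp p q) (Imp q p)"

abbreviation Exists :: "var \<Rightarrow> fm \<Rightarrow> fm" where
  "Exists x p \<equiv> Neg (Forall x (Neg p))"

abbreviation Foralls :: "var list \<Rightarrow> fm \<Rightarrow> fm" where
  "Foralls xs p \<equiv> foldr Forall xs p"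

abbreviation Existss :: "var list \<Rightarrow> fm \<Rightarrow> fm" where
  "Existss ys p \<equiv> foldr Exists ys p"

primrec FV :: "fm \<Rightarrow> var set" where
  "FV (Mem x y) = {x, y}"
| "FV (Eq x y) = {x, y}"
| "FV (Neg p) = FV p"
| "FV (Imp p q) = FV p \<union> FV q"
| "FV (Forall x p) = FV p - {x}"

definition sentence :: "fm \<Rightarrow> bool" where
  "sentence p \<longleftrightarrow> FV p = {}"

primrec quantifier_free :: "fm \<Rightarrow> bool" where
  "quantifier_free (Mem x y) = True"
| "quantifier_free (Eq x y) = True"
| "quantifier_free (Neg p) = quantifier_free p"
| "quantifier_free (Imp p q) = (quantifier_free p \<and> quantifier_free q)"
| "quantifier_free (Forall x p) = False"

primrec subformulas :: "fm \<Rightarrow> fm set" where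
  "subformulas (Mem x y) = {Mem x y}"
| "subformulas (Eq x y) = {Eq x y}"
| "subformulas (Neg p) = insert (Neg p) (subformulas p)"
| "subformulas (Imp p q) = insert (Imp p q) (subformulas p \<union> subformulas q)"
| "subformulas (Forall x p) = insert (Forall x p) (subformulas p)"

text \<open>A stratification is a map on the variables occurring (free or bound) in the formula.
  It is represented by a total function, whose values at other variables are irrelevant.
  Every occurrence of a variable name, free or bound, gets the same value.\<close>

definition stratification :: "(var \<Rightarrow> nat) \<Rightarrow> fm \<Rightarrow> bool" where
  "stratification \<sigma> p \<longleftrightarrow>
     (\<forall>x y. Mem x y \<in> subformulas p \<longrightarrow> \<sigma> y = \<sigma> x + 1) \<and>
     (\<forall>x y. Eq x y \<in> subformulas p \<longrightarrow> \<sigma> y = \<sigma> x)"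

definition stratified :: "fm \<Rightarrow> bool" where
  "stratified p \<longleftrightarrow> (\<exists>\<sigma>. stratification \<sigma> p)"

text \<open>\<open>subst x y p\<close> replaces the free occurrences of \<open>x\<close> in \<open>p\<close> by \<open>y\<close>. It does not rename
  bound variables, so it is used only under \<open>free_for x y p\<close> (no capture of \<open>y\<close>).\<close>

primrec subst :: "var \<Rightarrow> var \<Rightarrow> fm \<Rightarrow> fm" where
  "subst x y (Mem u v) = Mem (if u = x then y else u) (if v = x then y else v)"
| "subst x y (Eq u v) = Eq (if u = x then y else u) (if v = x then y else v)"
| "subst x y (Neg p) = Neg (subst x y p)"
| "subst x y (Imp p q) = Imp (subst x y p) (subst x y q)"
| "subst x y (Forall z p) = Forall z (if z = x then p else subst x y p)"

primrec free_for :: "var \<Rightarrow> var \<Rightarrow> fm \<Rightarrow> bool" where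
  "free_for x y (Mem u v) = True"
| "free_for x y (Eq u v) = True"
| "free_for x y (Neg p) = free_for x y p"
| "free_for x y (Imp p q) = (free_for x y p \<and> free_for x y q)"
| "free_for x y (Forall z p) = (x \<notin> FV (Forall z p) \<or> (z \<noteq> y \<and> free_for x y p))"

text \<open>Natural deduction for classical first-order logic with equality. Weakening is a rule
  because an infinite set of hypotheses may leave no variable available for \<open>ForallI\<close>.\<close>

inductive proves :: "fm set \<Rightarrow> fm \<Rightarrow> bool" (infix \<open>\<turnstile>\<close> 50) where
  Assm: "p \<in> \<Gamma> \<Longrightarrow> \<Gamma> \<turnstile> p"
| Weaken: "\<Delta> \<turnstile> p \<Longrightarrow> \<Delta> \<subseteq> \<Gamma> \<Longrightarrow> \<Gamma> \<turnstile> p"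
| ImpI: "insert p \<Gamma> \<turnstile> q \<Longrightarrow> \<Gamma> \<turnstile> Imp p q"
| ImpE: "\<Gamma> \<turnstile> Imp p q \<Longrightarrow> \<Gamma> \<turnstile> p \<Longrightarrow> \<Gamma> \<turnstile> q"
| Raa: "insert (Neg p) \<Gamma> \<turnstile> q \<Longrightarrow> insert (Neg p) \<Gamma> \<turnstile> Neg q \<Longrightarrow> \<Gamma> \<turnstile> p"
| ForallI: "\<Gamma> \<turnstile> p \<Longrightarrow> \<forall>q\<in>\<Gamma>. x \<notin> FV q \<Longrightarrow> \<Gamma> \<turnstile> Forall x p"
| ForallE: "\<Gamma> \<turnstile> Forall x p \<Longrightarrow> free_for x y p \<Longrightarrow> \<Gamma> \<turnstile> subst x y p"
| EqRefl: "\<Gamma> \<turnstile> Eq x x"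
| EqSubst: "\<Gamma> \<turnstile> Eq u v \<Longrightarrow> \<Gamma> \<turnstile> subst x u p \<Longrightarrow> free_for x u p \<Longrightarrow> free_for x v p
    \<Longrightarrow> \<Gamma> \<turnstile> subst x v p"

definition Extensionality :: fm where
  "Extensionality =
     Forall 0 (Forall 1 (Iff (Eq 0 1) (Forall 2 (Iff (Mem 2 0) (Mem 2 1)))))"

definition Comprehension :: "var list \<Rightarrow> var \<Rightarrow> var \<Rightarrow> fm \<Rightarrow> fm" where
  "Comprehension zs y x p = Foralls zs (Exists y (Forall x (Iff (Mem x y) p)))"

text \<open>Writing \<open>\<phi>(x, z)\<close> in the comprehension scheme means that the free variables of \<open>\<phi>\<close> are
  among \<open>x\<close> and the parameters; in particular the set variable \<open>y\<close> is not free in \<open>\<phi>\<close>.\<close>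

definition NF :: "fm set" where
  "NF = insert Extensionality
     {Comprehension zs y x p | zs y x p.
        stratified p \<and> distinct (x # y # zs) \<and> FV p \<subseteq> insert x (set zs)}"

end

theory Submission
  imports Defs "HOL-Library.Countable" "HOL-Library.Disjoint_Sets"
begin

text \<open>The argument is semantic. If \<open>NF\<close> decides neither way, completeness of the calculus
  (\<open>countermodel\<close>) gives a model of \<open>NF\<close> where \<open>\<phi>\<close> fails and another one where \<open>\<phi>\<close> holds.
  The contradiction comes from \<open>counterexample_transfers\<close>: a failure of \<open>\<phi>\<close> in one model
  \<open>(U, E)\<close> of \<open>NF\<close> can be copied into every other model \<open>(W, F)\<close>.

  Let the values \<open>a v\<close> of the universal variables be a counterexample in \<open>U\<close>. Values \<open>b v\<close> in \<open>W\<close>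
  are needed such that every choice of values for the \<open>y\<^sub>j\<close> in \<open>W\<close> can be answered by values in \<open>U\<close>
  that satisfy the same stratified atomic formulas. Build one finite partition of \<open>U\<close> for each
  type, from the bottom up: two elements lie in the same cell if they have the same relations to
  the \<open>a v\<close> of their own type and of the next type, and if they meet and include the same cells of
  the partition below (\<open>level\<close>). Then label the elements of \<open>W\<close>, type by type, with these cells.
  A cell \<open>{a v}\<close> labels a single element, which is taken as \<open>b v\<close>. All other cells label many
  elements. The labels have to respect membership in a weak sense: if \<open>x\<close> has label \<open>t\<close> and \<open>y\<close> has
  label \<open>q\<close>, then every \<open>z \<in> q\<close> contains some element of \<open>t\<close> if \<open>F x y\<close>, and omits some element
  of \<open>t\<close> otherwise (\<open>fits\<close>). Given such labels, the answers in \<open>U\<close> are found from the top type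
  down, each inside the cell that labels the element to be answered (\<open>matching_points\<close>). One type
  holds at most one \<open>y\<^sub>j\<close>, so each answer has to be adjusted only to the one just above it.

  The core is the construction of the labels of the next type (\<open>extend_labelling\<close>). A subset \<open>y\<close> of
  \<open>W\<close> imposes on a matching \<open>z\<close> in \<open>U\<close> only that \<open>z\<close> contain or omit certain representatives of
  finitely many cells. Infinitely many \<open>z\<close> do this, so some cell with several elements is always
  available as a label. In the other direction, each cell \<open>q\<close> has to occur as a label. A member of
  \<open>q\<close> that is a union of cells is copied by the corresponding union of label classes. Otherwise it
  cuts a cell that labels many elements, and this leaves many ways to copy it. All this uses only
  singletons, Boolean operations, \<open>{y. y \<subseteq> D}\<close> and \<open>{y. D \<subseteq> y}\<close>, which stratified comprehension
  provides.\<close>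

section \<open>Syntax\<close>

primrec vars :: "fm \<Rightarrow> var set" where
  "vars (Mem x y) = {x, y}"
| "vars (Eq x y) = {x, y}"
| "vars (Neg p) = vars p"
| "vars (Imp p q) = vars p \<union> vars q"
| "vars (Forall x p) = insert x (vars p)"

lemma finite_vars: "finite (vars p)"
  by (induction p) auto

lemma FV_subset_vars: "FV p \<subseteq> vars p"
  by (induction p) auto

lemma subst_idle: "x \<notin> FV p \<Longrightarrow> subst x y p = p"
  by (induction p) auto

lemma free_for_new: "y \<notin> vars p \<Longrightarrow> free_for x y p"
  by (induction p) auto

lemma FV_subst: "FV (subst x y p) \<subseteq> (FV p - {x}) \<union> {y}"
  by (induction p) auto

lemma size_subst: "size (subst x y p) = size p"
  by (induction p) auto

lemma free_for_subst_back: "y \<notin> vars p \<Longrightarrow> free_for y x (subst x y p)"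
proof (induction p)
  case (Forall z p)
  then have "y \<notin> FV p" using FV_subset_vars by auto
  then show ?case using Forall by auto
qed auto

lemma subst_subst_back: "y \<notin> vars p \<Longrightarrow> subst y x (subst x y p) = p"
proof (induction p)
  case (Forall z p)
  then have "y \<notin> FV p" using FV_subset_vars by auto
  then show ?case using Forall subst_idle by auto
qed auto

section \<open>Semantics\<close>

primrec sat :: "'a set \<Rightarrow> ('a \<Rightarrow> 'a \<Rightarrow> bool) \<Rightarrow> (var \<Rightarrow> 'a) \<Rightarrow> fm \<Rightarrow> bool" where
  "sat U E e (Mem x y) \<longleftrightarrow> E (e x) (e y)"
| "sat U E e (Eq x y) \<longleftrightarrow> e x = e y"
| "sat U E e (Neg p) \<longleftrightarrow> \<not> sat U E e p"
| "sat U E e (Imp p q) \<longleftrightarrow> (sat U E e p \<longrightarrow> sat U E e q)"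
| "sat U E e (Forall x p) \<longleftrightarrow> (\<forall>d\<in>U. sat U E (e(x := d)) p)"

lemma sat_cong:
  "(\<And>v. v \<in> FV p \<Longrightarrow> e v = e' v) \<Longrightarrow> sat U E e p \<longleftrightarrow> sat U E e' p"
proof (induction p arbitrary: e e')
  case (Forall x p)
  then have "sat U E (e(x := d)) p \<longleftrightarrow> sat U E (e'(x := d)) p" for d
    by (intro Forall.IH) auto
  then show ?case by simp
next
  case (Imp p q)
  then have "sat U E e p \<longleftrightarrow> sat U E e' p" "sat U E e q \<longleftrightarrow> sat U E e' q"
    by (metis FV.simps(4) UnCI)+
  then show ?case by simp
next
  case (Neg p)
  then show ?case by (metis FV.simps(3) sat.simps(3))
qed auto

lemma sat_subst:
  "free_for x y p \<Longrightarrow> sat U E e (subst x y p) \<longleftrightarrow> sat U E (e(x := e y)) p"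
proof (induction p arbitrary: e)
  case (Forall z p)
  show ?case
  proof (cases "x \<in> FV (Forall z p)")
    case False
    then have "subst x y (Forall z p) = Forall z p" by (rule subst_idle)
    moreover have "sat U E e (Forall z p) \<longleftrightarrow> sat U E (e(x := e y)) (Forall z p)"
      by (rule sat_cong) (use False in auto)
    ultimately show ?thesis by (simp only:)
  next
    case True
    then have "z \<noteq> y" "z \<noteq> x" "free_for x y p" using Forall.prems by auto
    then have "sat U E (e(z := d)) (subst x y p) \<longleftrightarrow> sat U E (e(x := e y, z := d)) p" for d
      using Forall.IH[of "e(z := d)"] fun_upd_twist[of z x e d "e y"] by (simp del: fun_upd_apply) simp
    then show ?thesis using \<open>z \<noteq> x\<close> by (simp del: fun_upd_apply)
  qed
qed auto

section \<open>Completeness of the calculus\<close>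

definition consistent :: "fm set \<Rightarrow> bool" where
  "consistent \<Gamma> \<longleftrightarrow> \<not> (\<exists>q. \<Gamma> \<turnstile> q \<and> \<Gamma> \<turnstile> Neg q)"

lemma explosion: "\<not> consistent \<Gamma> \<Longrightarrow> \<Gamma> \<turnstile> p"
  unfolding consistent_def by (meson Raa Weaken subset_insertI)

lemma cut: "\<Gamma> \<turnstile> p \<Longrightarrow> insert p \<Gamma> \<turnstile> q \<Longrightarrow> \<Gamma> \<turnstile> q"
  using ImpE ImpI by blast

lemma double_negation: "\<Gamma> \<turnstile> Neg (Neg p) \<Longrightarrow> \<Gamma> \<turnstile> p"
  by (rule Raa[where q = "Neg p"]) (auto intro: Assm Weaken)

lemma Neg_intro: "\<not> consistent (insert p \<Gamma>) \<Longrightarrow> \<Gamma> \<turnstile> Neg p"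
proof -
  assume inc: "\<not> consistent (insert p \<Gamma>)"
  have p: "insert (Neg (Neg p)) \<Gamma> \<turnstile> p" by (rule double_negation) (simp add: Assm)
  have all: "insert (Neg (Neg p)) \<Gamma> \<turnstile> q" for q
    by (rule cut[OF p], rule Weaken[OF explosion[OF inc]]) auto
  show ?thesis by (rule Raa[OF all all])
qed

lemma consistent_insert_Neg: "\<not> \<Gamma> \<turnstile> p \<Longrightarrow> consistent (insert (Neg p) \<Gamma>)"
  using double_negation Neg_intro by blast

text \<open>Compactness, which makes consistency pass to unions of chains.\<close>

lemma proves_finite:
  "\<Gamma> \<turnstile> p \<Longrightarrow> \<exists>\<Gamma>0\<subseteq>\<Gamma>. finite \<Gamma>0 \<and> \<Gamma>0 \<turnstile> p"
proof (induction rule: proves.induct)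
  case (Assm p \<Gamma>)
  then show ?case by (intro exI[of _ "{p}"]) (auto intro: proves.Assm)
next
  case (Weaken \<Delta> p \<Gamma>)
  then show ?case by blast
next
  case (ImpI p \<Gamma> q)
  then obtain G where G: "G \<subseteq> insert p \<Gamma>" "finite G" "G \<turnstile> q" by blast
  have "insert p (G - {p}) \<turnstile> q" by (rule proves.Weaken[OF G(3)]) auto
  then show ?case using G by (intro exI[of _ "G - {p}"]) (auto intro: proves.ImpI)
next
  case (ImpE \<Gamma> p q)
  then obtain G H where G: "G \<subseteq> \<Gamma>" "finite G" "G \<turnstile> Imp p q" "H \<subseteq> \<Gamma>" "finite H" "H \<turnstile> p"
    by blast
  have "G \<union> H \<turnstile> Imp p q" "G \<union> H \<turnstile> p"
    by (rule proves.Weaken[OF G(3)], simp) (rule proves.Weaken[OF G(6)], simp)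
  then have "G \<union> H \<turnstile> q" by (rule proves.ImpE)
  then show ?case using G by (intro exI[of _ "G \<union> H"]) auto
next
  case (Raa p \<Gamma> q)
  then obtain G H where G: "G \<subseteq> insert (Neg p) \<Gamma>" "finite G" "G \<turnstile> q"
      "H \<subseteq> insert (Neg p) \<Gamma>" "finite H" "H \<turnstile> Neg q"
    by blast
  let ?K = "(G \<union> H) - {Neg p}"
  have "insert (Neg p) ?K \<turnstile> q" "insert (Neg p) ?K \<turnstile> Neg q"
    by (rule proves.Weaken[OF G(3)], auto) (rule proves.Weaken[OF G(6)], auto)
  then have "?K \<turnstile> p" by (rule proves.Raa)
  then show ?case using G by (intro exI[of _ ?K]) auto
next
  case (ForallI \<Gamma> p x)
  then show ?case by (meson proves.ForallI subsetD)
next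
  case (ForallE \<Gamma> x p y)
  then show ?case by (meson proves.ForallE)
next
  case (EqRefl \<Gamma> x)
  then show ?case by (intro exI[of _ "{}"]) (auto intro: proves.EqRefl)
next
  case (EqSubst \<Gamma> u v x p)
  then obtain G H where G: "G \<subseteq> \<Gamma>" "finite G" "G \<turnstile> Eq u v" "H \<subseteq> \<Gamma>" "finite H" "H \<turnstile> subst x u p"
    by blast
  have "G \<union> H \<turnstile> Eq u v" "G \<union> H \<turnstile> subst x u p"
    by (rule proves.Weaken[OF G(3)], simp) (rule proves.Weaken[OF G(6)], simp)
  then have "G \<union> H \<turnstile> subst x v p" using EqSubst.hyps proves.EqSubst by blast
  then show ?case using G by (intro exI[of _ "G \<union> H"]) auto
qed

lemma consistent_Union_chain:
  assumes chain: "subset.chain UNIV C" and ne: "C \<noteq> {}" and cons: "\<And>\<Gamma>. \<Gamma> \<in> C \<Longrightarrow> consistent \<Gamma>"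
  shows "consistent (\<Union>C)"
  unfolding consistent_def
proof
  assume "\<exists>q. \<Union>C \<turnstile> q \<and> \<Union>C \<turnstile> Neg q"
  then obtain q G H where G: "G \<subseteq> \<Union>C" "finite G" "G \<turnstile> q" "H \<subseteq> \<Union>C" "finite H" "H \<turnstile> Neg q"
    using proves_finite by meson
  have "finite (G \<union> H)" "G \<union> H \<subseteq> \<Union>C" using G by auto
  from finite_subset_Union_chain[OF this ne chain]
  obtain \<Gamma> where "\<Gamma> \<in> C" "G \<union> H \<subseteq> \<Gamma>" .
  then have "\<Gamma> \<turnstile> q" "\<Gamma> \<turnstile> Neg q" using G Weaken by blast+
  then show False using cons[OF \<open>\<Gamma> \<in> C\<close>] consistent_def by blast
qed

text \<open>Renaming the bound variable of \<open>Forall x p\<close> to a fresh \<open>y\<close> is what makes the generalisation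
  possible even when \<open>x\<close> itself is free in \<open>\<Gamma>\<close>.\<close>

lemma generalise_new:
  assumes y: "y \<notin> vars p" "\<forall>q\<in>\<Gamma>. y \<notin> FV q" and p: "\<Gamma> \<turnstile> subst x y p"
  shows "\<Gamma> \<turnstile> Forall x p"
proof -
  let ?a = "Forall y (subst x y p)"
  have "{?a} \<turnstile> subst y x (subst x y p)"
    by (rule ForallE) (auto intro: Assm free_for_subst_back[OF y(1)])
  then have "{?a} \<turnstile> p" using subst_subst_back[OF y(1)] by simp
  moreover have "x \<notin> FV ?a" using FV_subst[of x y p] by auto
  ultimately have "{?a} \<turnstile> Forall x p" by (auto intro: ForallI)
  then have "insert ?a \<Gamma> \<turnstile> Forall x p" by (rule Weaken) simp
  moreover have "\<Gamma> \<turnstile> ?a" using p y by (auto intro: ForallI)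
  ultimately show ?thesis using cut by blast
qed

text \<open>If \<open>\<Gamma>\<close> refuted the witnessing implication, it would prove its premise. As \<open>y\<close> is fresh, it would
  then prove the conclusion, and hence the implication itself.\<close>

lemma consistent_insert_witness:
  assumes "consistent \<Gamma>" and y: "y \<notin> vars p" "\<forall>q\<in>\<Gamma>. y \<notin> FV q"
  shows "consistent (insert (Imp (subst x y p) (Forall x p)) \<Gamma>)"
proof (rule ccontr)
  assume "\<not> ?thesis"
  then have n: "\<Gamma> \<turnstile> Neg (Imp (subst x y p) (Forall x p))" (is "_ \<turnstile> Neg ?i") by (rule Neg_intro)
  have "\<not> consistent (insert (Neg (subst x y p)) \<Gamma>)"
  proof -
    let ?G = "insert (Neg (subst x y p)) \<Gamma>"
    have "\<not> consistent (insert (subst x y p) ?G)"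
      unfolding consistent_def by (auto intro!: exI[of _ "subst x y p"] Assm)
    then have "?G \<turnstile> ?i" by (intro ImpI explosion)
    moreover have "?G \<turnstile> Neg ?i" using n by (rule Weaken) auto
    ultimately show ?thesis unfolding consistent_def by blast
  qed
  then have "\<Gamma> \<turnstile> subst x y p" using consistent_insert_Neg by blast
  then have "\<Gamma> \<turnstile> Forall x p" using y generalise_new by blast
  then have "\<Gamma> \<turnstile> ?i" by (intro ImpI) (auto intro: Weaken)
  then show False using n assms(1) unfolding consistent_def by blast
qed

instance fm :: countable
  by countable_datatype

text \<open>The bound \<open>k\<close> forces infinitely many witnesses for every formula. It gives each element of
  the term model names outside any finite set of variables, which avoids capture later on.\<close>

definition witness_var :: "nat \<Rightarrow> fm \<Rightarrow> fm set \<Rightarrow> var" where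
  "witness_var k p \<Gamma> = (SOME y. k < y \<and> y \<notin> vars p \<and> (\<forall>q\<in>\<Gamma>. y \<notin> FV q))"

primrec witnessed :: "fm set \<Rightarrow> nat \<Rightarrow> fm set" where
  "witnessed \<Gamma> 0 = \<Gamma>"
| "witnessed \<Gamma> (Suc n) = (case from_nat n of (x, p, k) \<Rightarrow>
     insert (Imp (subst x (witness_var k p (witnessed \<Gamma> n)) p) (Forall x p)) (witnessed \<Gamma> n))"

lemma witness_var:
  assumes "finite (\<Union>(FV ` \<Gamma>))"
  shows "k < witness_var k p \<Gamma>" "witness_var k p \<Gamma> \<notin> vars p" "\<forall>q\<in>\<Gamma>. witness_var k p \<Gamma> \<notin> FV q"
proof -
  have "finite ({..k} \<union> vars p \<union> \<Union>(FV ` \<Gamma>))" using assms finite_vars by simp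
  from ex_new_if_finite[OF infinite_UNIV_nat this]
  obtain y where "y \<notin> {..k} \<union> vars p \<union> \<Union>(FV ` \<Gamma>)" ..
  then have "k < y \<and> y \<notin> vars p \<and> (\<forall>q\<in>\<Gamma>. y \<notin> FV q)" by auto
  then have "\<exists>y. k < y \<and> y \<notin> vars p \<and> (\<forall>q\<in>\<Gamma>. y \<notin> FV q)" by (rule exI)
  from someI_ex[OF this, folded witness_var_def]
  show "k < witness_var k p \<Gamma>" "witness_var k p \<Gamma> \<notin> vars p" "\<forall>q\<in>\<Gamma>. witness_var k p \<Gamma> \<notin> FV q"
    by blast+
qed

lemma finite_FV: "finite (FV p)"
  using FV_subset_vars finite_vars finite_subset by blast

lemma witnessed_invariant:
  assumes "consistent \<Gamma>" "finite (\<Union>(FV ` \<Gamma>))"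
  shows "consistent (witnessed \<Gamma> n) \<and> finite (\<Union>(FV ` witnessed \<Gamma> n))"
proof (induction n)
  case 0
  then show ?case using assms by simp
next
  case (Suc n)
  obtain x p k where n: "(from_nat n :: var \<times> fm \<times> nat) = (x, p, k)" by (rule prod_cases3)
  note IH = conjunct1[OF Suc] conjunct2[OF Suc]
  note y = witness_var[OF IH(2), of k p]
  let ?w = "Imp (subst x (witness_var k p (witnessed \<Gamma> n)) p) (Forall x p)"
  have "witnessed \<Gamma> (Suc n) = insert ?w (witnessed \<Gamma> n)"
    by (simp only: witnessed.simps n prod.case)
  moreover have "consistent (insert ?w (witnessed \<Gamma> n))"
    using IH(1) y(2,3) by (rule consistent_insert_witness)
  moreover have "finite (\<Union>(FV ` insert ?w (witnessed \<Gamma> n)))"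
    using IH(2) finite_FV[of ?w] by (simp only: image_insert Union_insert finite_Un simp_thms)
  ultimately show ?case by (simp only: simp_thms)
qed

text \<open>Each step adds one witnessing implication and so uses up finitely many variables, which leaves
  fresh ones for the next step. Zorn's lemma then completes the union; the witnessing implications
  persist in every larger set.\<close>

lemma maximal_witnessed_extension:
  assumes "consistent \<Gamma>" "finite (\<Union>(FV ` \<Gamma>))"
  shows "\<exists>\<Delta>. \<Gamma> \<subseteq> \<Delta> \<and> consistent \<Delta> \<and> (\<forall>p. p \<in> \<Delta> \<or> Neg p \<in> \<Delta>) \<and>
    (\<forall>x p k. \<exists>y>k. y \<notin> vars p \<and> Imp (subst x y p) (Forall x p) \<in> \<Delta>)"
proof -
  let ?H = "\<Union>(range (witnessed \<Gamma>))"
  have step: "witnessed \<Gamma> n \<subseteq> witnessed \<Gamma> (Suc n)" for n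
    by (auto split: prod.split)
  have mono: "witnessed \<Gamma> m \<subseteq> witnessed \<Gamma> n" if "m \<le> n" for m n
    by (rule lift_Suc_mono_le[of "witnessed \<Gamma>", OF step that])
  have "witnessed \<Gamma> m \<subseteq> witnessed \<Gamma> n \<or> witnessed \<Gamma> n \<subseteq> witnessed \<Gamma> m" for m n
    using mono nat_le_linear[of m n] by auto
  then have "subset.chain UNIV (range (witnessed \<Gamma>))"
    unfolding subset_chain_def by auto
  then have H: "consistent ?H"
    by (rule consistent_Union_chain) (use witnessed_invariant[OF assms] in auto)
  have wit: "\<exists>y>k. y \<notin> vars p \<and> Imp (subst x y p) (Forall x p) \<in> ?H" for x p k
  proof -
    define n where "n = to_nat (x, p, k)"
    let ?y = "witness_var k p (witnessed \<Gamma> n)"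
    have "Imp (subst x ?y p) (Forall x p) \<in> witnessed \<Gamma> (Suc n)" by (simp add: n_def)
    then show ?thesis
      using witness_var[of "witnessed \<Gamma> n" k p] witnessed_invariant[OF assms, of n] by blast
  qed
  let ?A = "{\<Delta>. ?H \<subseteq> \<Delta> \<and> consistent \<Delta>}"
  have "\<exists>M\<in>?A. \<forall>X\<in>?A. M \<subseteq> X \<longrightarrow> X = M"
  proof (rule subset_Zorn_nonempty)
    show "?A \<noteq> {}" using H by auto
    fix C assume C: "C \<noteq> {}" "subset.chain ?A C"
    then have "subset.chain UNIV C" "\<forall>X\<in>C. consistent X" "\<forall>X\<in>C. ?H \<subseteq> X"
      unfolding subset_chain_def by auto
    then have "consistent (\<Union>C)" "?H \<subseteq> \<Union>C" using C(1) consistent_Union_chain[of C] by auto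
    then show "\<Union>C \<in> ?A" by simp
  qed
  then obtain \<Delta> where D: "?H \<subseteq> \<Delta>" "consistent \<Delta>"
    and max: "\<And>X. ?H \<subseteq> X \<Longrightarrow> consistent X \<Longrightarrow> \<Delta> \<subseteq> X \<Longrightarrow> X = \<Delta>" by auto
  have "p \<in> \<Delta> \<or> Neg p \<in> \<Delta>" for p
  proof (cases "\<Delta> \<turnstile> p")
    case True
    have "consistent (insert p \<Delta>)"
      unfolding consistent_def using cut[OF True] D(2) consistent_def by blast
    then show ?thesis using max[of "insert p \<Delta>"] D(1) by blast
  next
    case False
    then have "consistent (insert (Neg p) \<Delta>)" by (rule consistent_insert_Neg)
    then show ?thesis using max[of "insert (Neg p) \<Delta>"] D(1) by blast
  qed
  moreover have "witnessed \<Gamma> 0 \<subseteq> \<Delta>" using D(1) by blast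
  moreover have "\<exists>y>k. y \<notin> vars p \<and> Imp (subst x y p) (Forall x p) \<in> \<Delta>" for x p k
    using wit[of k p x] D(1) by (meson subsetD)
  ultimately show ?thesis using D(2) by (intro exI[of _ \<Delta>]) (simp only: witnessed.simps simp_thms)
qed

text \<open>The term model of \<open>\<Delta>\<close>: variables modulo provable equality, each class being represented by
  its least member. Substitution in this syntax does not rename bound variables, so in the case of a
  quantifier every class has to be named by a variable that does not occur in the formula.\<close>

lemma term_model:
  assumes cons: "consistent \<Delta>" and max: "\<And>p. p \<in> \<Delta> \<or> Neg p \<in> \<Delta>"
    and wit: "\<And>x p k. \<exists>y>k. y \<notin> vars p \<and> Imp (subst x y p) (Forall x p) \<in> \<Delta>"
  defines "rep \<equiv> \<lambda>v. LEAST w. Eq v w \<in> \<Delta>"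
  shows "sat (range rep) (\<lambda>v w. Mem v w \<in> \<Delta>) rep p \<longleftrightarrow> p \<in> \<Delta>"
proof -
  have closed: "p \<in> \<Delta>" if "\<Delta> \<turnstile> p" for p
    using that max[of p] cons Assm unfolding consistent_def by blast
  have neg: "Neg p \<in> \<Delta> \<longleftrightarrow> p \<notin> \<Delta>" for p
    using max[of p] cons Assm unfolding consistent_def by blast
  have mp: "q \<in> \<Delta>" if "Imp p q \<in> \<Delta>" "p \<in> \<Delta>" for p q
    using closed ImpE Assm that by blast
  have imp: "Imp p q \<in> \<Delta> \<longleftrightarrow> (p \<in> \<Delta> \<longrightarrow> q \<in> \<Delta>)" for p q
  proof
    assume *: "p \<in> \<Delta> \<longrightarrow> q \<in> \<Delta>"
    show "Imp p q \<in> \<Delta>"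
    proof (cases "q \<in> \<Delta>")
      case True
      then show ?thesis by (intro closed ImpI) (auto intro: Assm)
    next
      case False
      then have "Neg p \<in> \<Delta>" using * neg by blast
      then have "\<not> consistent (insert p \<Delta>)"
        unfolding consistent_def by (auto intro!: exI[of _ p] Assm)
      then show ?thesis by (intro closed ImpI explosion)
    qed
  qed (use mp in blast)
  have refl: "Eq v v \<in> \<Delta>" for v by (intro closed EqRefl)
  have rewrite: "subst x v p \<in> \<Delta>" if "Eq u v \<in> \<Delta>" "subst x u p \<in> \<Delta>" "free_for x u p" "free_for x v p" for u v x p
    using that by (intro closed EqSubst[of _ u v]) (auto intro: Assm)
  have sym: "Eq v u \<in> \<Delta>" if "Eq u v \<in> \<Delta>" for u v
  proof -
    define x where "x = Suc (u + v)"
    have "x \<noteq> u" "x \<noteq> v" by (auto simp: x_def)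
    then show ?thesis using rewrite[OF that, of x "Eq x u"] refl by simp
  qed
  have trans: "Eq u w \<in> \<Delta>" if "Eq u v \<in> \<Delta>" "Eq v w \<in> \<Delta>" for u v w
  proof -
    define x where "x = Suc (u + v + w)"
    have "x \<noteq> u" "x \<noteq> v" "x \<noteq> w" by (auto simp: x_def)
    then show ?thesis using rewrite[OF that(2), of x "Eq u x"] that by simp
  qed
  have mem: "Mem u' v' \<in> \<Delta>" if "Mem u v \<in> \<Delta>" "Eq u u' \<in> \<Delta>" "Eq v v' \<in> \<Delta>" for u v u' v'
  proof -
    define x where "x = Suc (u + v + u' + v')"
    have x: "x \<noteq> u" "x \<noteq> v" "x \<noteq> u'" "x \<noteq> v'" by (auto simp: x_def)
    then have "Mem u' v \<in> \<Delta>" using rewrite[OF that(2), of x "Mem x v"] that by simp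
    then show ?thesis using x rewrite[OF that(3), of x "Mem u' x"] by simp
  qed
  have rep: "Eq v (rep v) \<in> \<Delta>" for v
    unfolding rep_def by (rule LeastI[of _ v]) (rule refl)
  have rep_eq: "rep u = rep v \<longleftrightarrow> Eq u v \<in> \<Delta>" for u v
  proof
    assume "rep u = rep v"
    then show "Eq u v \<in> \<Delta>" using rep sym trans by metis
  next
    assume "Eq u v \<in> \<Delta>"
    then have "Eq u w \<in> \<Delta> \<longleftrightarrow> Eq v w \<in> \<Delta>" for w using sym trans by blast
    then show "rep u = rep v" unfolding rep_def by simp
  qed
  have all: "Forall x p \<in> \<Delta> \<longleftrightarrow> (\<forall>y. y \<notin> vars p \<longrightarrow> subst x y p \<in> \<Delta>)" for x p
  proof
    assume "Forall x p \<in> \<Delta>"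
    then have "\<Delta> \<turnstile> Forall x p" by (rule Assm)
    then show "\<forall>y. y \<notin> vars p \<longrightarrow> subst x y p \<in> \<Delta>"
      using closed ForallE free_for_new by blast
  qed (use wit[of 0 p x] mp in blast)
  \<comment> \<open>The witnesses of \<open>\<exists>x. x = v\<close> give names of the class of \<open>v\<close> outside any finite set.\<close>
  have new_name: "\<exists>w. w \<notin> vars p \<and> rep w = rep v" for v p
  proof -
    obtain k where k: "\<forall>w\<in>vars p. w \<le> k" using finite_vars finite_nat_set_iff_bounded_le by blast
    define x where "x = Suc v"
    obtain w where w: "w > k" "w \<notin> vars (Neg (Eq x v))"
      "Imp (subst x w (Neg (Eq x v))) (Forall x (Neg (Eq x v))) \<in> \<Delta>"
      using wit by blast
    have "Forall x (Neg (Eq x v)) \<notin> \<Delta>"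
    proof
      assume "Forall x (Neg (Eq x v)) \<in> \<Delta>"
      then have "subst x v (Neg (Eq x v)) \<in> \<Delta>"
        by (intro closed ForallE[of _ x]) (auto intro: Assm)
      then show False using refl neg by (auto simp: x_def)
    qed
    then have "Eq w v \<in> \<Delta>" using w(3) mp neg by (auto simp: x_def)
    then show ?thesis using w(1) k rep_eq by (metis not_le)
  qed
  show ?thesis
  proof (induction "size p" arbitrary: p rule: less_induct)
    case less
    show ?case
    proof (cases p)
      case (Mem u v)
      then show ?thesis using mem rep sym by (metis sat.simps(1))
    next
      case (Eq u v)
      then show ?thesis using rep_eq by simp
    next
      case (Neg q)
      then show ?thesis using less[of q] neg by simp
    next
      case (Imp q r)
      then show ?thesis using less[of q] less[of r] imp by simp
    next
      case (Forall x q)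
      have IH: "sat (range rep) (\<lambda>v w. Mem v w \<in> \<Delta>) (rep(x := rep v)) q \<longleftrightarrow> subst x v q \<in> \<Delta>"
        if "v \<notin> vars q" for v
        using less[of "subst x v q"] Forall
        by (simp del: fun_upd_apply add: size_subst sat_subst[OF free_for_new[OF that]])
      have "sat (range rep) (\<lambda>v w. Mem v w \<in> \<Delta>) rep p \<longleftrightarrow>
        (\<forall>v. sat (range rep) (\<lambda>v w. Mem v w \<in> \<Delta>) (rep(x := rep v)) q)"
        using Forall by simp
      also have "\<dots> \<longleftrightarrow> (\<forall>v. v \<notin> vars q \<longrightarrow> sat (range rep) (\<lambda>v w. Mem v w \<in> \<Delta>) (rep(x := rep v)) q)"
        using new_name by metis
      also have "\<dots> \<longleftrightarrow> (\<forall>v. v \<notin> vars q \<longrightarrow> subst x v q \<in> \<Delta>)"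
        using IH by (simp del: fun_upd_apply)
      finally show ?thesis using all Forall by simp
    qed
  qed
qed

definition models :: "'a set \<Rightarrow> ('a \<Rightarrow> 'a \<Rightarrow> bool) \<Rightarrow> fm set \<Rightarrow> bool" where
  "models U E \<Gamma> \<longleftrightarrow> U \<noteq> {} \<and> (\<forall>p\<in>\<Gamma>. \<forall>e. range e \<subseteq> U \<longrightarrow> sat U E e p)"

theorem countermodel:
  assumes "\<And>q. q \<in> \<Gamma> \<Longrightarrow> sentence q" and "sentence p" and "\<not> \<Gamma> \<turnstile> p"
  obtains U :: "nat set" and E where "models U E (insert (Neg p) \<Gamma>)"
proof -
  let ?G = "insert (Neg p) \<Gamma>"
  have closed: "FV q = {}" if "q \<in> ?G" for q using that assms unfolding sentence_def by auto
  have "consistent ?G" using assms(3) by (rule consistent_insert_Neg)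
  moreover have "finite (\<Union>(FV ` ?G))" using closed by simp
  ultimately obtain \<Delta> where D: "?G \<subseteq> \<Delta>" "consistent \<Delta>" "\<And>p. p \<in> \<Delta> \<or> Neg p \<in> \<Delta>"
    "\<And>x p k. \<exists>y>k. y \<notin> vars p \<and> Imp (subst x y p) (Forall x p) \<in> \<Delta>"
    using maximal_witnessed_extension[of ?G] by auto
  note truth = term_model[OF D(2-4)]
  let ?rep = "\<lambda>v. LEAST w. Eq v w \<in> \<Delta>"
  have "sat (range ?rep) (\<lambda>v w. Mem v w \<in> \<Delta>) e q" if "q \<in> ?G" for q e
    using truth[of q] D(1) that closed[OF that] sat_cong[of q e ?rep] by auto
  then have "models (range ?rep) (\<lambda>v w. Mem v w \<in> \<Delta>) ?G" unfolding models_def by auto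
  then show ?thesis by (rule that)
qed

section \<open>Extensional structures with elementary set operations\<close>

locale membership =
  fixes U :: "'a set" and E :: "'a \<Rightarrow> 'a \<Rightarrow> bool"
begin

definition elts :: "'a \<Rightarrow> 'a set" where
  "elts x = {z \<in> U. E z x}"

definition is_set :: "'a set \<Rightarrow> bool" where
  "is_set D \<longleftrightarrow> D \<in> elts ` U"

end

text \<open>The consequences of \<open>NF\<close> on which the transfer rests. Here \<open>is_set D\<close> says that the subset
  \<open>D\<close> of the universe is the extension of an element.\<close>

locale nf_structure = membership +
  assumes nonempty: "U \<noteq> {}"
    and extensional: "inj_on elts U"
    and is_set_singleton: "x \<in> U \<Longrightarrow> is_set {x}"
    and is_set_Un: "is_set C \<Longrightarrow> is_set D \<Longrightarrow> is_set (C \<union> D)"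
    and is_set_compl: "is_set D \<Longrightarrow> is_set (U - D)"
    and is_set_subsets: "is_set D \<Longrightarrow> is_set {y \<in> U. elts y \<subseteq> D}"
    and is_set_supersets: "is_set D \<Longrightarrow> is_set {y \<in> U. D \<subseteq> elts y}"
begin

lemma elts_subset: "elts x \<subseteq> U"
  by (auto simp: elts_def)

lemma is_set_subset: "is_set D \<Longrightarrow> D \<subseteq> U"
  unfolding is_set_def using elts_subset by blast

lemma is_set_UNIV: "is_set U"
proof -
  obtain x where x: "x \<in> U" using nonempty by blast
  have "is_set ({x} \<union> (U - {x}))" using x by (intro is_set_Un is_set_compl is_set_singleton)
  then show ?thesis using x by (simp add: insert_absorb)
qed

lemma is_set_empty: "is_set {}"
  using is_set_compl[OF is_set_UNIV] by simp

lemma is_set_UN: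
  "finite I \<Longrightarrow> (\<And>i. i \<in> I \<Longrightarrow> is_set (D i)) \<Longrightarrow> is_set (\<Union>i\<in>I. D i)"
  by (induction I rule: finite_induct) (auto intro: is_set_empty is_set_Un)

lemma is_set_finite: "finite A \<Longrightarrow> A \<subseteq> U \<Longrightarrow> is_set A"
  using is_set_UN[of A "\<lambda>x. {x}"] is_set_singleton by auto

lemma is_set_Int: "is_set C \<Longrightarrow> is_set D \<Longrightarrow> is_set (C \<inter> D)"
proof -
  assume "is_set C" "is_set D"
  then have "is_set (U - ((U - C) \<union> (U - D)))" by (intro is_set_compl is_set_Un)
  moreover have "U - ((U - C) \<union> (U - D)) = C \<inter> D" using is_set_subset[OF \<open>is_set C\<close>] by blast
  ultimately show ?thesis by simp
qed

lemma is_set_Diff: "is_set C \<Longrightarrow> is_set D \<Longrightarrow> is_set (C - D)"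
proof -
  assume "is_set C" "is_set D"
  then have "is_set (C \<inter> (U - D))" by (intro is_set_compl is_set_Int)
  moreover have "C \<inter> (U - D) = C - D" using is_set_subset[OF \<open>is_set C\<close>] by blast
  ultimately show ?thesis by simp
qed

lemma is_set_Ball:
  "finite I \<Longrightarrow> (\<And>i. i \<in> I \<Longrightarrow> is_set {y \<in> U. Q i y}) \<Longrightarrow> is_set {y \<in> U. \<forall>i\<in>I. Q i y}"
proof (induction I rule: finite_induct)
  case empty
  then show ?case using is_set_UNIV by simp
next
  case (insert i I)
  then have "is_set ({y \<in> U. Q i y} \<inter> {y \<in> U. \<forall>i\<in>I. Q i y})" by (intro is_set_Int) auto
  moreover have "{y \<in> U. Q i y} \<inter> {y \<in> U. \<forall>i\<in>I. Q i y} = {y \<in> U. \<forall>i\<in>insert i I. Q i y}" by auto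
  ultimately show ?case by simp
qed

text \<open>\<open>pat y\<close> records the answers to finitely many questions about \<open>y\<close>, so a condition on it is a
  finite Boolean combination of these questions.\<close>

lemma is_set_finite_pattern:
  assumes "finite S" and sub: "\<And>y. y \<in> U \<Longrightarrow> pat y \<subseteq> S"
    and S: "\<And>s. s \<in> S \<Longrightarrow> is_set {y \<in> U. s \<in> pat y}"
  shows "is_set {y \<in> U. \<Phi> (pat y)}"
proof -
  have one: "is_set {y \<in> U. s \<in> pat y \<longleftrightarrow> s \<in> \<pi>}" if "s \<in> S" for s \<pi>
  proof (cases "s \<in> \<pi>")
    case True
    then show ?thesis using S[OF that] by simp
  next
    case False
    moreover have "U - {y \<in> U. s \<in> pat y} = {y \<in> U. s \<notin> pat y}" by blast
    ultimately show ?thesis using is_set_compl[OF S[OF that]] by simp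
  qed
  have "is_set (\<Union>\<pi>\<in>{\<pi>. \<pi> \<subseteq> S \<and> \<Phi> \<pi>}. {y \<in> U. \<forall>s\<in>S. s \<in> pat y \<longleftrightarrow> s \<in> \<pi>})"
    using \<open>finite S\<close> one by (intro is_set_UN is_set_Ball) auto
  moreover have "(\<forall>s\<in>S. s \<in> pat y \<longleftrightarrow> s \<in> \<pi>) \<longleftrightarrow> pat y = \<pi>" if "y \<in> U" "\<pi> \<subseteq> S" for y \<pi>
    using sub[OF that(1)] that(2) by blast
  then have "(\<Union>\<pi>\<in>{\<pi>. \<pi> \<subseteq> S \<and> \<Phi> \<pi>}. {y \<in> U. \<forall>s\<in>S. s \<in> pat y \<longleftrightarrow> s \<in> \<pi>}) = {y \<in> U. \<Phi> (pat y)}"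
    using sub by fastforce
  ultimately show ?thesis by simp
qed

definition set_of :: "'a set \<Rightarrow> 'a" where
  "set_of D = inv_into U elts D"

lemma set_of: "is_set D \<Longrightarrow> set_of D \<in> U" "is_set D \<Longrightarrow> elts (set_of D) = D"
  unfolding is_set_def set_of_def by (simp_all add: inv_into_into f_inv_into_f)

text \<open>The map \<open>x \<mapsto> {x}\<close> is injective and misses the empty set.\<close>

lemma infinite_universe: "infinite U"
proof
  assume fin: "finite U"
  let ?f = "\<lambda>x. set_of {x}"
  have f: "?f x \<in> U" "elts (?f x) = {x}" if "x \<in> U" for x
    using set_of[OF is_set_singleton[OF that]] .
  have "inj_on ?f U"
  proof (rule inj_onI)
    fix x y assume xy: "x \<in> U" "y \<in> U" and eq: "?f x = ?f y"
    have "{x} = {y}" using f(2)[OF xy(1)] f(2)[OF xy(2)] unfolding eq by (rule subst)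
    then show "x = y" by simp
  qed
  then have "?f ` U = U" using fin f by (intro endo_inj_surj) auto
  moreover have "set_of {} \<notin> ?f ` U" using set_of(2)[OF is_set_empty] f(2) by force
  ultimately show False using set_of(1)[OF is_set_empty] by simp
qed

text \<open>Finitely many requirements of membership or non-membership never pin an element down. This
  is what gives room for elements that differ from all of the prescribed ones.\<close>

lemma infinite_sets_between:
  assumes fin: "finite A" "finite B" and sub: "A \<subseteq> U" and disj: "A \<inter> B = {}"
  shows "infinite {y \<in> U. A \<subseteq> elts y \<and> elts y \<inter> B = {}}"
proof -
  let ?f = "\<lambda>x. set_of (insert x A)"
  have f: "?f x \<in> U" "elts (?f x) = insert x A" if "x \<in> U" for x
    using set_of[OF is_set_finite[of "insert x A"]] fin sub that by auto
  then have "inj_on ?f (U - (A \<union> B))"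
    by (intro inj_onI) (metis Diff_iff UnI1 insertE insertI1)
  moreover have "infinite (U - (A \<union> B))" using fin infinite_universe by auto
  ultimately have "infinite (?f ` (U - (A \<union> B)))" by (simp add: finite_image_iff)
  moreover have "?f ` (U - (A \<union> B)) \<subseteq> {y \<in> U. A \<subseteq> elts y \<and> elts y \<inter> B = {}}"
    using f disj by auto
  ultimately show ?thesis using finite_subset by blast
qed

text \<open>Whether \<open>q\<close> may label a given set will depend only on which cells of \<open>P\<close> its members meet and
  include. Under this condition one member of \<open>q\<close> speaks for all of them.\<close>

definition determined :: "'a set set \<Rightarrow> 'a set set \<Rightarrow> bool" where
  "determined P Q \<longleftrightarrow> (\<forall>q\<in>Q. \<forall>x\<in>q. \<forall>y\<in>q. \<forall>t\<in>P.
     (t \<inter> elts x = {} \<longleftrightarrow> t \<inter> elts y = {}) \<and> (t \<subseteq> elts x \<longleftrightarrow> t \<subseteq> elts y))"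

end

section \<open>Labelling one structure by cells of the other\<close>

text \<open>Greedy choice: what was chosen earlier, together with \<open>B\<close>, is too small to exhaust the next
  reservoir.\<close>

lemma disjoint_choice:
  assumes "finite Q" "finite B"
    and "\<And>q. q \<in> Q \<Longrightarrow> \<exists>A\<subseteq>C q. finite A \<and> card B + card Q * k \<le> card A"
  shows "\<exists>Y. (\<forall>q\<in>Q. Y q \<subseteq> C q - B \<and> finite (Y q) \<and> card (Y q) = k) \<and> disjoint_family_on Y Q"
  using assms
proof (induction Q arbitrary: B rule: finite_induct)
  case empty
  then show ?case by (auto simp: disjoint_family_on_def)
next
  case (insert q Q)
  obtain A where A: "A \<subseteq> C q" "finite A" "card B + card (insert q Q) * k \<le> card A"
    using insert.prems(2)[of q] by blast
  have "k \<le> card (A - B)"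
    using A(3) card_insert_disjoint[OF insert.hyps] diff_card_le_card_Diff[OF insert.prems(1), of A]
    by (simp only: mult_Suc)
  then obtain T where T: "T \<subseteq> A - B" "card T = k" "finite T"
    by (metis obtain_subset_with_card_n)
  have "\<exists>A\<subseteq>C q'. finite A \<and> card (B \<union> T) + card Q * k \<le> card A" if "q' \<in> Q" for q'
  proof -
    have "\<exists>A\<subseteq>C q'. finite A \<and> card B + card (insert q Q) * k \<le> card A"
      using insert.prems(2)[of q'] that by simp
    moreover have "card (B \<union> T) + card Q * k \<le> card B + card (insert q Q) * k"
      using card_insert_disjoint[OF insert.hyps] T(2) card_Un_le[of B T] by simp
    ultimately show ?thesis by (meson order_trans)
  qed
  then obtain Y where Y: "\<forall>q\<in>Q. Y q \<subseteq> C q - (B \<union> T) \<and> finite (Y q) \<and> card (Y q) = k"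
    "disjoint_family_on Y Q"
    using insert.IH[of "B \<union> T"] insert.prems(1) T(3) by blast
  let ?Y = "Y(q := T)"
  have "\<forall>q'\<in>insert q Q. ?Y q' \<subseteq> C q' - B \<and> finite (?Y q') \<and> card (?Y q') = k"
    using Y(1) T A(1) by auto
  moreover have "disjoint_family_on ?Y (insert q Q)"
    unfolding disjoint_family_on_def
  proof (intro ballI impI)
    fix m n assume "m \<in> insert q Q" "n \<in> insert q Q" "m \<noteq> n"
    then consider "m \<in> Q" "n \<in> Q" "m \<noteq> q" "n \<noteq> q" | "m = q" "n \<in> Q" "n \<noteq> q" | "n = q" "m \<in> Q" "m \<noteq> q" by blast
    then show "?Y m \<inter> ?Y n = {}"
    proof cases
      case 1
      then show ?thesis using Y(2) \<open>m \<noteq> n\<close> by (simp add: disjoint_family_on_def)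
    next
      case 2
      then show ?thesis using Y(1) by auto
    next
      case 3
      then show ?thesis using Y(1) by auto
    qed
  qed
  ultimately show ?case by blast
qed

locale nf_pair = M: nf_structure U E + N: nf_structure W F
  for U :: "'a set" and E and W :: "'b set" and F
begin

definition fibre :: "('b \<Rightarrow> 'a set) \<Rightarrow> 'a set \<Rightarrow> 'b set" where
  "fibre L t = {x \<in> W. L x = t}"

text \<open>A singleton cell \<open>{a}\<close> is the label of exactly one element, the counterpart of \<open>a\<close>. The other cells
  have to label many elements, so that there are many sets on the next level that cut their label
  class.\<close>

definition labelling :: "nat \<Rightarrow> 'a set set \<Rightarrow> ('b \<Rightarrow> 'a set) \<Rightarrow> bool" where
  "labelling k P L \<longleftrightarrow> (\<forall>x\<in>W. L x \<in> P) \<and>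
     (\<forall>t\<in>P. N.is_set (fibre L t) \<and>
       (if is_singleton t then is_singleton (fibre L t)
        else \<exists>A\<subseteq>fibre L t. finite A \<and> k \<le> card A))"

text \<open>The label \<open>q\<close> of \<open>y\<close> is honest about membership: whether or not \<open>x\<close> belongs to \<open>y\<close>, each \<open>z\<close> in
  \<open>q\<close> stands in the same relation to at least one element of the cell \<open>L x\<close>.\<close>

definition fits :: "('b \<Rightarrow> 'a set) \<Rightarrow> 'a set \<Rightarrow> 'b \<Rightarrow> bool" where
  "fits L q y \<longleftrightarrow> (\<forall>x\<in>W. \<forall>z\<in>q.
     (F x y \<longrightarrow> L x \<inter> M.elts z \<noteq> {}) \<and> (\<not> F x y \<longrightarrow> \<not> L x \<subseteq> M.elts z))"

end

text \<open>One step upwards: \<open>P\<close> and \<open>L\<close> are the partition and the labelling of one level, \<open>Q\<close> is the partition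
  of the next one. The bound in the assumption on \<open>L\<close> allows \<open>k + 1\<close> elements of \<open>W\<close> to be reserved for
  every cell of \<open>Q\<close>, after one element has been set aside for each.\<close>

locale labelled_step = nf_pair +
  fixes P Q :: "'a set set" and L :: "'b \<Rightarrow> 'a set" and k :: nat
  assumes P: "finite P" "partition_on U P" and Q: "finite Q" "partition_on U Q"
    and det: "M.determined P Q"
    and L: "labelling (card Q * (k + 2)) P L"
begin

lemma L_in: "x \<in> W \<Longrightarrow> L x \<in> P"
  using L unfolding labelling_def by blast

lemma fibre_set: "t \<in> P \<Longrightarrow> N.is_set (fibre L t)"
  using L unfolding labelling_def by blast

lemma singleton_fibre: "t \<in> P \<Longrightarrow> is_singleton t \<Longrightarrow> is_singleton (fibre L t)"
  using L unfolding labelling_def by auto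

lemma large_fibre:
  "t \<in> P \<Longrightarrow> \<not> is_singleton t \<Longrightarrow> \<exists>A\<subseteq>fibre L t. finite A \<and> card Q * (k + 2) \<le> card A"
  using L unfolding labelling_def by (auto simp del: mult_Suc_right add_2_eq_Suc')

lemma cells:
  shows "t \<in> P \<Longrightarrow> t \<noteq> {}" "q \<in> Q \<Longrightarrow> q \<noteq> {}" "t \<in> P \<Longrightarrow> t \<subseteq> U" "q \<in> Q \<Longrightarrow> q \<subseteq> U"
    "\<Union>P = U" "\<Union>Q = U"
  using P(2) Q(2) unfolding partition_on_def by blast+

lemma P_unique: "t \<in> P \<Longrightarrow> t' \<in> P \<Longrightarrow> x \<in> t \<Longrightarrow> x \<in> t' \<Longrightarrow> t = t'"
  using P(2) unfolding partition_on_def disjoint_def by blast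

lemma Q_unique: "q \<in> Q \<Longrightarrow> q' \<in> Q \<Longrightarrow> x \<in> q \<Longrightarrow> x \<in> q' \<Longrightarrow> q = q'"
  using Q(2) unfolding partition_on_def disjoint_def by blast

lemma meets_iff:
  "q \<in> Q \<Longrightarrow> x \<in> q \<Longrightarrow> y \<in> q \<Longrightarrow> t \<in> P \<Longrightarrow> t \<inter> M.elts x = {} \<longleftrightarrow> t \<inter> M.elts y = {}"
  using det[unfolded M.determined_def, rule_format, of q x y t] by simp

lemma inside_iff:
  "q \<in> Q \<Longrightarrow> x \<in> q \<Longrightarrow> y \<in> q \<Longrightarrow> t \<in> P \<Longrightarrow> t \<subseteq> M.elts x \<longleftrightarrow> t \<subseteq> M.elts y"
  using det[unfolded M.determined_def, rule_format, of q x y t] by simp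

text \<open>By \<open>det\<close> it suffices to test a single member of the cell.\<close>

lemma fitsI:
  assumes q: "q \<in> Q" "z \<in> q"
    and "\<And>x. x \<in> W \<Longrightarrow> F x y \<Longrightarrow> L x \<inter> M.elts z \<noteq> {}"
    and "\<And>x. x \<in> W \<Longrightarrow> \<not> F x y \<Longrightarrow> \<not> L x \<subseteq> M.elts z"
  shows "fits L q y"
  unfolding fits_def
proof (intro ballI conjI impI)
  fix x z' assume x: "x \<in> W" and z': "z' \<in> q"
  note t = L_in[OF x]
  show "L x \<inter> M.elts z' \<noteq> {}" if "F x y"
    using assms(3)[OF x that] meets_iff[OF q z' t] by simp
  show "\<not> L x \<subseteq> M.elts z'" if "\<not> F x y"
    using assms(4)[OF x that] inside_iff[OF q z' t] by simp
qed

lemma card_Q: "card Q > 0"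
  using cells(6) M.nonempty Q(1) by (auto simp: card_gt_0_iff)

lemma fibre_nonempty: "t \<in> P \<Longrightarrow> fibre L t \<noteq> {}"
proof (cases "is_singleton t")
  case True
  assume "t \<in> P"
  then show ?thesis using singleton_fibre True by (auto simp: is_singleton_def)
next
  case False
  assume "t \<in> P"
  then obtain A where "A \<subseteq> fibre L t" "card Q * (k + 2) \<le> card A"
    using large_fibre False by blast
  moreover from this(2) card_Q have "A \<noteq> {}" by auto
  ultimately show ?thesis by blast
qed

text \<open>Choose in each cell of \<open>P\<close> one element to be contained in \<open>z\<close> and one to be omitted, as far as \<open>y\<close>
  requires it. If \<open>y\<close> requires both, the cell labels two elements of \<open>W\<close> and is therefore not a
  singleton, so the two choices can differ. Infinitely many \<open>z\<close> meet these requirements and \<open>Q\<close> is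
  finite, so one cell contains several such \<open>z\<close>.\<close>

lemma generic_cell:
  assumes y: "y \<in> W"
  shows "\<exists>q\<in>Q. \<not> is_singleton q \<and> fits L q y"
proof -
  define Ins where "Ins = {t \<in> P. \<exists>x\<in>W. L x = t \<and> F x y}"
  define Outs where "Outs = {t \<in> P. \<exists>x\<in>W. L x = t \<and> \<not> F x y}"
  have "\<exists>inn out. inn \<in> t \<and> out \<in> t \<and> (t \<in> Ins \<longrightarrow> t \<in> Outs \<longrightarrow> inn \<noteq> out)"
    if t: "t \<in> P" for t
  proof (cases "is_singleton t")
    case True
    then obtain x where x: "fibre L t = {x}"
      using singleton_fibre[OF t] by (auto simp: is_singleton_def)
    have "w = x" if "w \<in> W" "L w = t" for w using x that unfolding fibre_def by blast
    then have "t \<notin> Ins \<or> t \<notin> Outs" unfolding Ins_def Outs_def by blast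
    then show ?thesis using cells(1)[OF t] by blast
  next
    case False
    then show ?thesis using cells(1)[OF t] unfolding is_singleton_def by blast
  qed
  then have "\<forall>t. \<exists>inn out. t \<in> P \<longrightarrow>
      inn \<in> t \<and> out \<in> t \<and> (t \<in> Ins \<longrightarrow> t \<in> Outs \<longrightarrow> inn \<noteq> out)" by blast
  then obtain inn out where io: "\<And>t. t \<in> P \<Longrightarrow>
      inn t \<in> t \<and> out t \<in> t \<and> (t \<in> Ins \<longrightarrow> t \<in> Outs \<longrightarrow> inn t \<noteq> out t)"
    unfolding choice_iff by blast
  have sub: "Ins \<subseteq> P" "Outs \<subseteq> P" unfolding Ins_def Outs_def by auto
  define Z where "Z = {z \<in> U. inn ` Ins \<subseteq> M.elts z \<and> M.elts z \<inter> out ` Outs = {}}"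
  have "infinite Z"
    unfolding Z_def
  proof (rule M.infinite_sets_between)
    show "finite (inn ` Ins)" "finite (out ` Outs)"
      using sub[THEN finite_subset] P(1) by auto
    show "inn ` Ins \<subseteq> U" using io sub cells(3) by blast
    have "inn s \<noteq> out t" if "s \<in> Ins" "t \<in> Outs" for s t
    proof
      assume eq: "inn s = out t"
      have P: "s \<in> P" "t \<in> P" using sub that by blast+
      have "s = t" using P_unique[OF P, of "inn s"] io[OF P(1)] io[OF P(2)] eq by simp
      then show False using io[OF P(1)] eq that by simp
    qed
    then show "inn ` Ins \<inter> out ` Outs = {}" by blast
  qed
  moreover have "Z = (\<Union>q\<in>Q. q \<inter> Z)" using cells(6) unfolding Z_def by blast
  ultimately obtain q where q: "q \<in> Q" "infinite (q \<inter> Z)"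
    using Q(1) by (metis (no_types, lifting) finite_UN)
  have "q \<inter> Z \<noteq> {}" using q(2) by auto
  then obtain z where z: "z \<in> q" "z \<in> Z" by blast
  have "\<not> is_singleton q" using q(2) by (auto simp: is_singleton_def)
  moreover have "fits L q y"
  proof (rule fitsI[OF q(1) z(1)])
    fix x assume x: "x \<in> W"
    note t = L_in[OF x]
    show "L x \<inter> M.elts z \<noteq> {}" if "F x y"
    proof -
      have "L x \<in> Ins" using x t that unfolding Ins_def by blast
      then show ?thesis using io[OF t] z(2) unfolding Z_def by blast
    qed
    show "\<not> L x \<subseteq> M.elts z" if "\<not> F x y"
    proof -
      have "L x \<in> Outs" using x t that unfolding Outs_def by blast
      then show ?thesis using io[OF t] z(2) unfolding Z_def by blast
    qed
  qed
  ultimately show ?thesis using q(1) by blast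
qed

text \<open>Whether a label fits \<open>y\<close> depends only on the finite object \<open>pat y\<close>. Choosing the label as a
  function of \<open>pat y\<close> makes its label classes sets of the structure \<open>W\<close>.\<close>

definition pat :: "'b \<Rightarrow> ('a set \<times> bool) set" where
  "pat y = (\<lambda>x. (L x, F x y)) ` W"

definition good :: "('a set \<times> bool) set \<Rightarrow> 'a set \<Rightarrow> bool" where
  "good \<pi> q \<longleftrightarrow> q \<in> Q \<and> \<not> is_singleton q \<and>
    (\<forall>(t, b)\<in>\<pi>. \<forall>z\<in>q. (b \<longrightarrow> t \<inter> M.elts z \<noteq> {}) \<and> (\<not> b \<longrightarrow> \<not> t \<subseteq> M.elts z))"

definition fallback :: "'b \<Rightarrow> 'a set" where
  "fallback y = (SOME q. good (pat y) q)"

lemma fallback: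
  assumes y: "y \<in> W"
  shows "fallback y \<in> Q" "\<not> is_singleton (fallback y)" "fits L (fallback y) y"
proof -
  have good_iff: "good (pat y) q \<longleftrightarrow> q \<in> Q \<and> \<not> is_singleton q \<and> fits L q y" for q
    unfolding good_def pat_def fits_def by auto
  then have "\<exists>q. good (pat y) q" using generic_cell[OF y] by blast
  then have "good (pat y) (fallback y)" unfolding fallback_def by (rule someI_ex)
  then show "fallback y \<in> Q" "\<not> is_singleton (fallback y)" "fits L (fallback y) y"
    using good_iff by blast+
qed

lemma is_set_fallback: "N.is_set {y \<in> W. fallback y = q}"
  unfolding fallback_def
proof (rule N.is_set_finite_pattern[where S = "P \<times> UNIV" and \<Phi> = "\<lambda>\<pi>. (SOME q. good \<pi> q) = q"])
  show "finite (P \<times> (UNIV :: bool set))" using P(1) by simp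
  show "pat y \<subseteq> P \<times> UNIV" for y unfolding pat_def using L_in by auto
  fix s :: "'a set \<times> bool" assume "s \<in> P \<times> UNIV"
  then obtain t b where s: "s = (t, b)" "t \<in> P" by auto
  show "N.is_set {y \<in> W. s \<in> pat y}"
  proof (cases b)
    case True
    have "N.is_set (W - {y \<in> W. N.elts y \<subseteq> W - fibre L t})"
      using fibre_set[OF s(2)] by (intro N.is_set_compl N.is_set_subsets)
    moreover have "W - {y \<in> W. N.elts y \<subseteq> W - fibre L t} = {y \<in> W. s \<in> pat y}"
      using s True unfolding pat_def fibre_def N.elts_def by auto
    ultimately show ?thesis by simp
  next
    case False
    have "N.is_set (W - {y \<in> W. fibre L t \<subseteq> N.elts y})"
      using fibre_set[OF s(2)] by (intro N.is_set_compl N.is_set_supersets)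
    moreover have "W - {y \<in> W. fibre L t \<subseteq> N.elts y} = {y \<in> W. s \<in> pat y}"
      using s False unfolding pat_def fibre_def N.elts_def by auto
    ultimately show ?thesis by simp
  qed
qed

text \<open>The copy in \<open>W\<close> of the part of \<open>z \<in> q\<close> that is a union of cells of \<open>P\<close>.\<close>

definition base :: "'a set \<Rightarrow> 'b set" where
  "base q = {x \<in> W. \<forall>z\<in>q. L x \<subseteq> M.elts z}"

definition mixed :: "'a set \<Rightarrow> bool" where
  "mixed q \<longleftrightarrow> (\<exists>t\<in>P. \<exists>z\<in>q. t \<inter> M.elts z \<noteq> {} \<and> \<not> t \<subseteq> M.elts z)"

definition cand :: "'a set \<Rightarrow> 'b set" where
  "cand q = {y \<in> W. fits L q y}"

lemma is_set_base: "N.is_set (base q)"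
proof -
  have "base q = (\<Union>t\<in>{t \<in> P. \<forall>z\<in>q. t \<subseteq> M.elts z}. fibre L t)"
    unfolding base_def fibre_def using L_in by auto
  then show ?thesis using P(1) fibre_set by (auto intro!: N.is_set_UN)
qed

lemma in_base: "q \<in> Q \<Longrightarrow> z \<in> q \<Longrightarrow> x \<in> W \<Longrightarrow> x \<in> base q \<longleftrightarrow> L x \<subseteq> M.elts z"
  unfolding base_def using inside_iff L_in by blast

text \<open>For a cell cut by \<open>z\<close>, omitting its whole label class is as honest as any other choice, because
  \<open>fits\<close> asks only for one witness. Hence \<open>base q\<close> is a candidate whether or not \<open>q\<close> is mixed.\<close>

lemma base_in_cand:
  assumes "q \<in> Q"
  shows "N.set_of (base q) \<in> cand q"
proof -
  note y = N.set_of[OF is_set_base[of q]]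
  obtain z where z: "z \<in> q" using cells(2)[OF assms] by blast
  have "F x (N.set_of (base q)) \<longleftrightarrow> L x \<subseteq> M.elts z" if "x \<in> W" for x
    using y(2) in_base[OF assms z that] that unfolding N.elts_def by blast
  then have "fits L q (N.set_of (base q))"
    using cells(1)[OF L_in] by (intro fitsI[OF assms z]) blast+
  then show ?thesis using y(1) unfolding cand_def by blast
qed

text \<open>If \<open>z \<in> q\<close> cuts the cell \<open>t\<close>, then \<open>base q\<close> may be enlarged by any one element labelled \<open>t\<close>. As \<open>t\<close>
  has at least two elements, there are many such.\<close>

lemma mixed_cand:
  assumes q: "q \<in> Q" "mixed q"
  shows "\<exists>A\<subseteq>cand q. finite A \<and> card Q * (k + 2) \<le> card A"
proof -
  obtain t z where t: "t \<in> P" "z \<in> q" "t \<inter> M.elts z \<noteq> {}" "\<not> t \<subseteq> M.elts z"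
    using q(2) unfolding mixed_def by blast
  then have "\<not> is_singleton t" by (auto simp: is_singleton_def)
  then obtain A where A: "A \<subseteq> fibre L t" "finite A" "card Q * (k + 2) \<le> card A"
    using large_fibre[OF t(1)] by blast
  let ?f = "\<lambda>x. N.set_of (insert x (base q))"
  have A_W: "x \<in> W" "L x = t" "x \<notin> base q" if "x \<in> A" for x
    using A(1) that t in_base[OF q(1) t(2)] unfolding fibre_def by auto
  have f: "?f x \<in> W" "N.elts (?f x) = insert x (base q)" if "x \<in> A" for x
    using N.set_of[OF N.is_set_Un[OF N.is_set_singleton is_set_base]] A_W(1)[OF that] by auto
  have "inj_on ?f A"
    by (intro inj_onI) (metis A_W(3) f(2) insertE insertI1)
  then have "card (?f ` A) = card A" by (rule card_image)
  moreover have "?f ` A \<subseteq> cand q"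
  proof
    fix y assume "y \<in> ?f ` A"
    then obtain x where x: "x \<in> A" "y = ?f x" by blast
    have F: "F w y \<longleftrightarrow> w = x \<or> L w \<subseteq> M.elts z" if "w \<in> W" for w
      using f(2)[OF x(1)] x(2) that in_base[OF q(1) t(2) that] unfolding N.elts_def by blast
    have "fits L q y"
      using F cells(1)[OF L_in] A_W(2)[OF x(1)] t(3) by (intro fitsI[OF q(1) t(2)]) blast+
    then show "y \<in> cand q" unfolding cand_def using f(1) x by blast
  qed
  ultimately show ?thesis using A by (intro exI[of _ "?f ` A"]) auto
qed

lemma unmixed_elts:
  assumes q: "\<not> mixed q" "z \<in> q"
  shows "M.elts z = \<Union>{t \<in> P. t \<subseteq> M.elts z}"
proof -
  have "\<exists>t\<in>P. x \<in> t \<and> t \<subseteq> M.elts z" if "x \<in> M.elts z" for x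
  proof -
    have "x \<in> \<Union>P" using M.elts_subset[of z] that cells(5) by blast
    then obtain t where "t \<in> P" "x \<in> t" by blast
    then show ?thesis using q that unfolding mixed_def by blast
  qed
  then show ?thesis by blast
qed

lemma unmixed_unique:
  assumes q: "q \<in> Q" "\<not> mixed q" "z \<in> q" and q': "q' \<in> Q" "\<not> mixed q'" "z' \<in> q'"
    and same: "\<And>t. t \<in> P \<Longrightarrow> t \<subseteq> M.elts z \<longleftrightarrow> t \<subseteq> M.elts z'"
  shows "z = z'"
proof -
  have "M.elts z = M.elts z'"
    using unmixed_elts[OF q(2,3)] unmixed_elts[OF q'(2,3)] same
    by (metis (no_types, lifting) Collect_cong)
  then show ?thesis
    using M.extensional cells(4) q q' by (metis inj_on_def subsetD)
qed

text \<open>A member of an unmixed cell is the union of the cells of \<open>P\<close> that it includes, and these are the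
  same for all members of the cell.\<close>

lemma unmixed_singleton:
  assumes "q \<in> Q" "\<not> mixed q"
  shows "is_singleton q"
proof -
  obtain z where z: "z \<in> q" using cells(2)[OF assms(1)] by blast
  have "z' = z" if "z' \<in> q" for z'
    using unmixed_unique[OF assms that assms z] inside_iff[OF assms(1) that z] by blast
  then have "q = {z}" using z by blast
  then show ?thesis by (simp add: is_singleton_def)
qed

lemma base_inject:
  assumes q: "q \<in> Q" "\<not> mixed q" "q' \<in> Q" "\<not> mixed q'"
    and eq: "N.set_of (base q) = N.set_of (base q')"
  shows "q = q'"
proof -
  have base: "base q = base q'" using N.set_of(2)[OF is_set_base] eq by metis
  obtain z z' where z: "z \<in> q" "z' \<in> q'" using cells(2) q by blast
  have "t \<subseteq> M.elts z \<longleftrightarrow> t \<subseteq> M.elts z'" if t: "t \<in> P" for t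
  proof -
    obtain x where x: "x \<in> W" "L x = t" using fibre_nonempty[OF t] unfolding fibre_def by blast
    then show ?thesis using in_base[OF q(1) z(1)] in_base[OF q(3) z(2)] base by blast
  qed
  then have "z = z'" by (rule unmixed_unique[OF q(1,2) z(1) q(3,4) z(2)])
  then show ?thesis using Q_unique q z by blast
qed

text \<open>Unmixed cells receive their only natural candidate \<open>base q\<close>; these are collected in \<open>B\<close>. The
  mixed cells then choose among their many candidates, avoiding \<open>B\<close> and one another.\<close>

lemma reserved_points:
  "\<exists>Z. disjoint_family_on Z Q \<and> (\<forall>q\<in>Q. Z q \<subseteq> cand q \<and> finite (Z q) \<and>
     (if is_singleton q then is_singleton (Z q) else k \<le> card (Z q)))"
proof -
  define B where "B = (\<lambda>q. N.set_of (base q)) ` {q \<in> Q. \<not> mixed q}"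
  have B: "finite B" "card B \<le> card Q"
    unfolding B_def using Q(1) by (auto intro: order_trans[OF card_image_le card_mono])
  define Qm where "Qm = {q \<in> Q. mixed q}"
  have "\<exists>A\<subseteq>cand q. finite A \<and> card B + card Qm * (k + 1) \<le> card A" if "q \<in> Qm" for q
  proof -
    have "card Qm \<le> card Q" unfolding Qm_def using Q(1) by (intro card_mono) auto
    then have "card B + card Qm * (k + 1) \<le> card Q + card Q * (k + 1)"
      using B(2) by (intro add_mono mult_le_mono1)
    also have "\<dots> = card Q * (k + 2)" by simp
    finally have le: "card B + card Qm * (k + 1) \<le> card Q * (k + 2)" .
    obtain A where "A \<subseteq> cand q" "finite A" "card Q * (k + 2) \<le> card A"
      using mixed_cand[of q] \<open>q \<in> Qm\<close> unfolding Qm_def by blast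
    then show ?thesis using le order_trans by blast
  qed
  then obtain Y where Y: "\<forall>q\<in>Qm. Y q \<subseteq> cand q - B \<and> finite (Y q) \<and> card (Y q) = k + 1"
    "disjoint_family_on Y Qm"
    using disjoint_choice[of Qm B cand "k + 1"] B(1) Q(1) unfolding Qm_def by auto
  define Z where "Z q = (if \<not> mixed q then {N.set_of (base q)}
    else if is_singleton q then {SOME y. y \<in> Y q} else Y q)" for q
  have Z_Y: "Z q \<subseteq> Y q" if "q \<in> Q" "mixed q" for q
  proof -
    have "Y q \<noteq> {}" using Y(1) that unfolding Qm_def by fastforce
    then show ?thesis using that unfolding Z_def by (auto intro: some_in_eq[THEN iffD2])
  qed
  show ?thesis
  proof (intro exI[of _ Z] conjI ballI)
    fix q assume q: "q \<in> Q"
    show "Z q \<subseteq> cand q"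
    proof (cases "mixed q")
      case True
      then show ?thesis using Z_Y[OF q] Y(1) q unfolding Qm_def by blast
    next
      case False
      then show ?thesis using base_in_cand[OF q] unfolding Z_def by simp
    qed
    show "finite (Z q)" using Y(1) q unfolding Qm_def Z_def by auto
    show "if is_singleton q then is_singleton (Z q) else k \<le> card (Z q)"
      using unmixed_singleton[OF q] Y(1) q unfolding Z_def Qm_def by auto
  next
    have "Z q \<inter> Z q' = {}" if q: "q \<in> Q" "q' \<in> Q" "q \<noteq> q'" for q q'
    proof -
      have unmixed_B: "Z r \<subseteq> B" if "r \<in> Q" "\<not> mixed r" for r
        using that unfolding B_def Z_def by simp
      have mixed_B: "Z r \<inter> B = {}" if "r \<in> Q" "mixed r" for r
        using that Z_Y[OF that] Y(1) unfolding Qm_def by blast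
      consider "mixed q" "mixed q'" | "\<not> mixed q" "\<not> mixed q'" | "mixed q" "\<not> mixed q'"
        | "\<not> mixed q" "mixed q'" by blast
      then show ?thesis
      proof cases
        case 1
        then have "Y q \<inter> Y q' = {}" using Y(2) q unfolding disjoint_family_on_def Qm_def by simp
        then show ?thesis using Z_Y q 1 by blast
      next
        case 2
        then show ?thesis using base_inject[OF q(1) _ q(2)] q(3) unfolding Z_def by auto
      next
        case 3
        then show ?thesis using unmixed_B[OF q(2)] mixed_B[OF q(1)] by blast
      next
        case 4
        then show ?thesis using unmixed_B[OF q(1)] mixed_B[OF q(2)] by blast
      qed
    qed
    then show "disjoint_family_on Z Q" by (simp add: disjoint_family_on_def)
  qed
qed

text \<open>Reserved elements get the label they are reserved for, and everything else gets its fallback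
  label. Fallback labels are never singletons, so a singleton cell labels its reserved element
  only. The label classes are sets because the reserved elements are finite in number.\<close>

lemma extend_labelling: "\<exists>K. labelling k Q K \<and> (\<forall>y\<in>W. fits L (K y) y)"
proof -
  obtain Z where disj: "disjoint_family_on Z Q"
    and Z: "\<forall>q\<in>Q. Z q \<subseteq> cand q \<and> finite (Z q) \<and>
      (if is_singleton q then is_singleton (Z q) else k \<le> card (Z q))"
    using reserved_points by blast
  have Z_W: "Z q \<subseteq> W" if "q \<in> Q" for q using Z that unfolding cand_def by blast
  define K where "K y = (if \<exists>q\<in>Q. y \<in> Z q then THE q. q \<in> Q \<and> y \<in> Z q else fallback y)" for y
  have K1: "K y = q" if "q \<in> Q" "y \<in> Z q" for q y
  proof -
    have "(THE q. q \<in> Q \<and> y \<in> Z q) = q"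
      using that disj unfolding disjoint_family_on_def by (intro the_equality) blast+
    then show ?thesis unfolding K_def using that by auto
  qed
  have K2: "K y = fallback y" if "\<not> (\<exists>q\<in>Q. y \<in> Z q)" for y
    unfolding K_def using that by simp
  have K: "K y \<in> Q \<and> fits L (K y) y" if "y \<in> W" for y
  proof (cases "\<exists>q\<in>Q. y \<in> Z q")
    case True
    then show ?thesis using K1 Z unfolding cand_def by auto
  next
    case False
    then show ?thesis using K2 fallback[OF that] by simp
  qed
  let ?R = "\<Union>q\<in>Q. Z q"
  have fibre_K: "fibre K q = Z q \<union> ({y \<in> W. fallback y = q} - ?R)" if "q \<in> Q" for q
  proof
    show "fibre K q \<subseteq> Z q \<union> ({y \<in> W. fallback y = q} - ?R)"
      unfolding fibre_def using K1 K2 by fastforce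
    show "Z q \<union> ({y \<in> W. fallback y = q} - ?R) \<subseteq> fibre K q"
      unfolding fibre_def using K1[OF that] K2 Z_W[OF that] by fastforce
  qed
  have "labelling k Q K"
    unfolding labelling_def
  proof (intro conjI ballI)
    show "K y \<in> Q" if "y \<in> W" for y using K[OF that] by blast
    fix q assume q: "q \<in> Q"
    have "N.is_set ?R" using Q(1) Z Z_W by (intro N.is_set_finite) auto
    moreover have "N.is_set (Z q)" using Z Z_W q by (intro N.is_set_finite) auto
    ultimately show "N.is_set (fibre K q)"
      unfolding fibre_K[OF q] using is_set_fallback by (intro N.is_set_Un N.is_set_Diff) simp_all
    show "if is_singleton q then is_singleton (fibre K q)
      else \<exists>A\<subseteq>fibre K q. finite A \<and> k \<le> card A"
    proof (cases "is_singleton q")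
      case True
      then have "{y \<in> W. fallback y = q} = {}" using fallback(2) by blast
      then have "fibre K q = Z q" using fibre_K[OF q] by (simp only: empty_Diff Un_empty_right)
      then show ?thesis using True Z q by simp
    next
      case False
      then show ?thesis using Z q fibre_K[OF q] by (auto intro!: exI[of _ "Z q"])
    qed
  qed
  then show ?thesis using K by blast
qed

end

section \<open>Transfer of assignments between structures\<close>

text \<open>Two assignments that \<open>\<sigma>\<close>-stratified quantifier-free formulas in the variables \<open>A\<close> cannot tell
  apart.\<close>

definition same_atoms ::
    "(var \<Rightarrow> nat) \<Rightarrow> var set \<Rightarrow> ('a \<Rightarrow> 'a \<Rightarrow> bool) \<Rightarrow> (var \<Rightarrow> 'a) \<Rightarrow>
      ('b \<Rightarrow> 'b \<Rightarrow> bool) \<Rightarrow> (var \<Rightarrow> 'b) \<Rightarrow> bool" where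
  "same_atoms \<sigma> A E e F f \<longleftrightarrow> (\<forall>u\<in>A. \<forall>v\<in>A.
     (\<sigma> v = \<sigma> u \<longrightarrow> (e u = e v \<longleftrightarrow> f u = f v)) \<and>
     (\<sigma> v = Suc (\<sigma> u) \<longrightarrow> (E (e u) (e v) \<longleftrightarrow> F (f u) (f v))))"

definition kernel_classes :: "'a set \<Rightarrow> ('a \<Rightarrow> 'c) \<Rightarrow> 'a set set" where
  "kernel_classes U f = (\<lambda>x. {y \<in> U. f y = f x}) ` U"

lemma partition_kernel_classes: "partition_on U (kernel_classes U f)"
  unfolding partition_on_def disjoint_def kernel_classes_def by auto

lemma finite_kernel_classes: "finite (f ` U) \<Longrightarrow> finite (kernel_classes U f)"
proof -
  assume "finite (f ` U)"
  moreover have "kernel_classes U f = (\<lambda>c. {y \<in> U. f y = c}) ` f ` U"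
    unfolding kernel_classes_def by (simp add: image_image)
  ultimately show ?thesis by simp
qed

lemma kernel_classes_eq: "t \<in> kernel_classes U f \<Longrightarrow> x \<in> t \<Longrightarrow> y \<in> t \<Longrightarrow> f x = f y"
  unfolding kernel_classes_def by auto

context nf_structure
begin

definition key :: "(var \<Rightarrow> nat) \<Rightarrow> var set \<Rightarrow> (var \<Rightarrow> 'a) \<Rightarrow> nat \<Rightarrow> 'a set set \<Rightarrow> 'a \<Rightarrow>
    var set \<times> var set \<times> 'a set set \<times> 'a set set" where
  "key \<sigma> V a i P x = ({v \<in> V. \<sigma> v = i \<and> x = a v}, {v \<in> V. \<sigma> v = Suc i \<and> E x (a v)},
     {t \<in> P. t \<inter> elts x \<noteq> {}}, {t \<in> P. t \<subseteq> elts x})"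

text \<open>Cells with index \<open>Suc i\<close> are meant for elements of type \<open>i\<close>. The shift lets the construction start
  from the trivial partition, for which a labelling costs nothing.\<close>

primrec level :: "(var \<Rightarrow> nat) \<Rightarrow> var set \<Rightarrow> (var \<Rightarrow> 'a) \<Rightarrow> nat \<Rightarrow> 'a set set" where
  "level \<sigma> V a 0 = {U}"
| "level \<sigma> V a (Suc i) = kernel_classes U (key \<sigma> V a i (level \<sigma> V a i))"

lemma partition_level: "partition_on U (level \<sigma> V a i)"
proof (cases i)
  case 0
  then show ?thesis using nonempty by (auto simp: partition_on_def disjoint_def)
next
  case (Suc j)
  then show ?thesis by (simp add: partition_kernel_classes)
qed

lemma level_Suc_key:
  assumes "t \<in> level \<sigma> V a (Suc i)" "x \<in> t" "y \<in> t"
  shows "key \<sigma> V a i (level \<sigma> V a i) x = key \<sigma> V a i (level \<sigma> V a i) y"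
  using assms unfolding level.simps by (rule kernel_classes_eq)

lemma finite_level: "finite V \<Longrightarrow> finite (level \<sigma> V a i)"
proof (induction i)
  case (Suc i)
  let ?P = "level \<sigma> V a i"
  have "key \<sigma> V a i ?P ` U \<subseteq> Pow V \<times> Pow V \<times> Pow ?P \<times> Pow ?P"
    unfolding key_def by auto
  then have "finite (key \<sigma> V a i ?P ` U)"
    by (rule finite_subset) (use Suc in simp)
  then show ?case by (simp add: finite_kernel_classes)
qed simp

lemma determined_level: "determined (level \<sigma> V a i) (level \<sigma> V a (Suc i))"
  unfolding determined_def
proof (intro ballI)
  fix q x y t
  assume "q \<in> level \<sigma> V a (Suc i)" "x \<in> q" "y \<in> q" and t: "t \<in> level \<sigma> V a i"
  then have "key \<sigma> V a i (level \<sigma> V a i) x = key \<sigma> V a i (level \<sigma> V a i) y"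
    using level_Suc_key by blast
  then have "{t \<in> level \<sigma> V a i. t \<inter> elts x \<noteq> {}} = {t \<in> level \<sigma> V a i. t \<inter> elts y \<noteq> {}}"
    "{t \<in> level \<sigma> V a i. t \<subseteq> elts x} = {t \<in> level \<sigma> V a i. t \<subseteq> elts y}"
    unfolding key_def by simp_all
  then show "(t \<inter> elts x = {} \<longleftrightarrow> t \<inter> elts y = {}) \<and> (t \<subseteq> elts x \<longleftrightarrow> t \<subseteq> elts y)"
    using t by blast
qed

lemma singleton_level:
  assumes "v \<in> V" "a v \<in> U"
  shows "{a v} \<in> level \<sigma> V a (Suc (\<sigma> v))"
proof -
  let ?k = "key \<sigma> V a (\<sigma> v) (level \<sigma> V a (\<sigma> v))"
  have "y = a v" if "?k y = ?k (a v)" for y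
  proof -
    have "{w \<in> V. \<sigma> w = \<sigma> v \<and> y = a w} = {w \<in> V. \<sigma> w = \<sigma> v \<and> a v = a w}"
      using that unfolding key_def by simp
    then show ?thesis using assms(1) by auto
  qed
  then have "{y \<in> U. ?k y = ?k (a v)} = {a v}" using assms(2) by blast
  then show ?thesis using assms(2) unfolding level.simps kernel_classes_def by blast
qed

lemma level_decides:
  assumes "v \<in> V" "\<sigma> v = Suc i" "t \<in> level \<sigma> V a (Suc i)" "x \<in> t" "y \<in> t"
  shows "E x (a v) \<longleftrightarrow> E y (a v)"
proof -
  have "key \<sigma> V a i (level \<sigma> V a i) x = key \<sigma> V a i (level \<sigma> V a i) y"
    using assms(3-5) by (rule level_Suc_key)
  then have "{v \<in> V. \<sigma> v = Suc i \<and> E x (a v)} = {v \<in> V. \<sigma> v = Suc i \<and> E y (a v)}"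
    unfolding key_def by simp
  then show ?thesis using assms(1,2) by blast
qed

end

context nf_pair
begin

lemma labelling_mono: "labelling k P L \<Longrightarrow> m \<le> k \<Longrightarrow> labelling m P L"
  unfolding labelling_def by (meson order_trans)

text \<open>Every step consumes part of the multiplicity of the labels, so the induction has to supply
  arbitrarily large \<open>k\<close> on the levels below.\<close>

lemma labelling_chain:
  assumes fin: "\<And>i. finite (P i)" and part: "\<And>i. partition_on U (P i)"
    and det: "\<And>i. M.determined (P i) (P (Suc i))" and P0: "P 0 = {U}"
  shows "\<exists>L. (\<forall>i\<le>n. labelling k (P i) (L i)) \<and> (\<forall>i<n. \<forall>y\<in>W. fits (L i) (L (Suc i) y) y)"
proof (induction n arbitrary: k)
  case 0
  have "\<not> is_singleton U" using M.infinite_universe by (auto simp: is_singleton_def)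
  moreover obtain A where "A \<subseteq> W" "finite A" "card A = k"
    using infinite_arbitrarily_large[OF N.infinite_universe] by blast
  ultimately have "labelling k (P 0) (\<lambda>_. U)"
    unfolding labelling_def P0 fibre_def using N.is_set_UNIV by auto
  then show ?case by (intro exI[of _ "\<lambda>_ _. U"]) simp
next
  case (Suc n)
  let ?m = "card (P (Suc n)) * (k + 2)"
  obtain L where L: "\<forall>i\<le>n. labelling (max k ?m) (P i) (L i)"
    "\<forall>i<n. \<forall>y\<in>W. fits (L i) (L (Suc i) y) y"
    using Suc[of "max k ?m"] by blast
  have "labelling ?m (P n) (L n)"
    using L(1)[rule_format, OF order_refl] by (rule labelling_mono) simp
  then interpret step: labelled_step U E W F "P n" "P (Suc n)" "L n" k
    using fin part det by unfold_locales auto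
  obtain K where K: "labelling k (P (Suc n)) K" "\<forall>y\<in>W. fits (L n) (K y) y"
    using step.extend_labelling by blast
  have "labelling k (P i) (L i)" if "i \<le> n" for i
    using L(1)[rule_format, OF that] by (rule labelling_mono) simp
  then show ?case
    using L(2) K by (intro exI[of _ "L(Suc n := K)"]) (auto simp: le_Suc_eq less_Suc_eq)
qed

text \<open>The points are chosen from the top down. Once \<open>c (Suc i)\<close> has been chosen in the cell of
  \<open>d (Suc i)\<close>, honesty of that label yields \<open>c i\<close> in the cell of \<open>d i\<close> with the right membership.\<close>

lemma matching_points:
  assumes L: "\<And>i x. i \<le> n \<Longrightarrow> x \<in> W \<Longrightarrow> L i x \<in> P i" and ne: "\<And>i t. t \<in> P i \<Longrightarrow> t \<noteq> {}"
    and fits: "\<And>i y. i < n \<Longrightarrow> y \<in> W \<Longrightarrow> fits (L i) (L (Suc i) y) y"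
    and sub: "\<And>i t. t \<in> P i \<Longrightarrow> t \<subseteq> U" and d: "\<And>i. d i \<in> W"
  shows "\<exists>c. (\<forall>i\<le>n. c i \<in> L i (d i)) \<and> (\<forall>i<n. F (d i) (d (Suc i)) \<longleftrightarrow> E (c i) (c (Suc i)))"
proof -
  have "\<exists>c. c m = z \<and> (\<forall>i\<le>m. c i \<in> L i (d i)) \<and> (\<forall>i<m. F (d i) (d (Suc i)) \<longleftrightarrow> E (c i) (c (Suc i)))"
    if "m \<le> n" "z \<in> L m (d m)" for m z
    using that
  proof (induction m arbitrary: z)
    case 0
    then show ?case by (intro exI[of _ "\<lambda>_. z"]) simp
  next
    case (Suc m)
    have fz: "fits (L m) (L (Suc m) (d (Suc m))) (d (Suc m))" using fits d Suc.prems(1) by simp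
    have sub': "L m (d m) \<subseteq> U" using L[of m] sub[of _ m] d Suc.prems(1) by simp
    have "\<exists>w\<in>L m (d m). F (d m) (d (Suc m)) \<longleftrightarrow> E w z"
    proof (cases "F (d m) (d (Suc m))")
      case True
      then have "L m (d m) \<inter> M.elts z \<noteq> {}" using fz d Suc.prems(2) unfolding fits_def by simp
      then show ?thesis using True unfolding M.elts_def by blast
    next
      case False
      then have "\<not> L m (d m) \<subseteq> M.elts z" using fz d Suc.prems(2) unfolding fits_def by simp
      then show ?thesis using False sub' unfolding M.elts_def by blast
    qed
    then obtain w where w: "w \<in> L m (d m)" "F (d m) (d (Suc m)) \<longleftrightarrow> E w z" by blast
    obtain c where c: "c m = w" "\<forall>i\<le>m. c i \<in> L i (d i)"
      "\<forall>i<m. F (d i) (d (Suc i)) \<longleftrightarrow> E (c i) (c (Suc i))"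
      using Suc.IH[of w] w(1) Suc.prems(1) by auto
    then show ?case
      using w Suc.prems(2) by (intro exI[of _ "c(Suc m := z)"]) (auto simp: le_Suc_eq less_Suc_eq)
  qed
  moreover have "L n (d n) \<noteq> {}" using L ne d by blast
  ultimately show ?thesis by blast
qed

text \<open>Here \<open>V\<close> holds the universal and \<open>Y\<close> the existential variables. The value \<open>b v\<close> is the unique
  element with label \<open>{a v}\<close>, and \<open>f v\<close> always lies in the cell that labels \<open>f' v\<close>. For atomic formulas
  that involve a variable of \<open>V\<close> the cells carry all of the information; two variables of \<open>Y\<close> have
  different types, so \<open>matching_points\<close> takes care of them.\<close>

theorem transfer_assignment:
  fixes \<sigma> :: "var \<Rightarrow> nat"
  assumes V: "finite V" "a ` V \<subseteq> U" and Y: "finite Y" "inj_on \<sigma> Y" "V \<inter> Y = {}"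
  shows "\<exists>b. b ` V \<subseteq> W \<and> (\<forall>f'. f' ` (V \<union> Y) \<subseteq> W \<longrightarrow> (\<forall>v\<in>V. f' v = b v) \<longrightarrow>
    (\<exists>f. f ` (V \<union> Y) \<subseteq> U \<and> (\<forall>v\<in>V. f v = a v) \<and> same_atoms \<sigma> (V \<union> Y) F f' E f))"
proof -
  let ?P = "M.level \<sigma> V a"
  have cells: "t \<noteq> {}" "t \<subseteq> U" if "t \<in> ?P i" for t i
    using M.partition_level[of \<sigma> V a i] that unfolding partition_on_def by blast+
  have unique: "t = t'" if "t \<in> ?P i" "t' \<in> ?P i" "x \<in> t" "x \<in> t'" for t t' x i
    using M.partition_level[of \<sigma> V a i] that unfolding partition_on_def disjoint_def by blast
  define n where "n = Suc (Max (insert 0 (\<sigma> ` (V \<union> Y))))"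
  have n: "Suc (\<sigma> v) \<le> n" if "v \<in> V \<union> Y" for v
    unfolding n_def using V(1) Y(1) that by (simp add: Max_ge)
  obtain L where L: "\<forall>i\<le>n. labelling 1 (?P i) (L i)"
    "\<forall>i<n. \<forall>y\<in>W. fits (L i) (L (Suc i) y) y"
    using labelling_chain[of ?P n 1] M.finite_level[OF V(1)] M.partition_level M.determined_level
    by auto
  have L_in: "L i x \<in> ?P i" if "i \<le> n" "x \<in> W" for i x
    using L(1) that unfolding labelling_def by blast
  have fits: "fits (L i) (L (Suc i) y) y" if "i < n" "y \<in> W" for i y
    using L(2) that by simp
  have "\<exists>x. fibre (L (Suc (\<sigma> v))) {a v} = {x}" if v: "v \<in> V" for v
  proof -
    have "{a v} \<in> ?P (Suc (\<sigma> v))" using M.singleton_level V(2) v by blast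
    moreover have "labelling 1 (?P (Suc (\<sigma> v))) (L (Suc (\<sigma> v)))" using L(1) n v by blast
    ultimately have "is_singleton (fibre (L (Suc (\<sigma> v))) {a v})"
      unfolding labelling_def by (metis is_singletonI)
    then show ?thesis by (simp add: is_singleton_def)
  qed
  then obtain b where b: "\<And>v. v \<in> V \<Longrightarrow> fibre (L (Suc (\<sigma> v))) {a v} = {b v}" by metis
  have b_W: "b v \<in> W" and b_label: "L (Suc (\<sigma> v)) (b v) = {a v}" if "v \<in> V" for v
    using b[OF that] unfolding fibre_def by blast+
  have b_unique: "x = b v" if "v \<in> V" "x \<in> W" "L (Suc (\<sigma> v)) x = {a v}" for v x
    using b[OF that(1)] that unfolding fibre_def by blast
  have "\<exists>f. f ` (V \<union> Y) \<subseteq> U \<and> (\<forall>v\<in>V. f v = a v) \<and>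
      same_atoms \<sigma> (V \<union> Y) F f' E f"
    if f'_W: "f' ` (V \<union> Y) \<subseteq> W" and f'_V: "\<forall>v\<in>V. f' v = b v" for f'
  proof -
    obtain w0 where w0: "w0 \<in> W" using N.nonempty by blast
    \<comment> \<open>Levels that carry no variable of \<open>Y\<close> are filled with an arbitrary point.\<close>
    define d where "d i = (if \<exists>y\<in>Y. Suc (\<sigma> y) = i then f' (THE y. y \<in> Y \<and> Suc (\<sigma> y) = i) else w0)" for i
    have d_Y: "d (Suc (\<sigma> y)) = f' y" if "y \<in> Y" for y
    proof -
      have "(THE z. z \<in> Y \<and> Suc (\<sigma> z) = Suc (\<sigma> y)) = y"
        using that Y(2) by (auto simp: inj_on_def)
      then show ?thesis unfolding d_def using that by auto
    qed
    have d_W: "d i \<in> W" for i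
    proof (cases "\<exists>y\<in>Y. Suc (\<sigma> y) = i")
      case True
      then obtain y where "y \<in> Y" "i = Suc (\<sigma> y)" by blast
      then show ?thesis using d_Y f'_W by auto
    next
      case False
      then show ?thesis unfolding d_def using w0 by simp
    qed
    have "\<exists>c. (\<forall>i\<le>n. c i \<in> L i (d i)) \<and> (\<forall>i<n. F (d i) (d (Suc i)) \<longleftrightarrow> E (c i) (c (Suc i)))"
      by (rule matching_points[where P = ?P]) (use L_in cells fits d_W in simp_all)
    then obtain c where c: "\<forall>i\<le>n. c i \<in> L i (d i)"
      "\<forall>i<n. F (d i) (d (Suc i)) \<longleftrightarrow> E (c i) (c (Suc i))" by (elim exE conjE) (rule that)
    define f where "f v = (if v \<in> V then a v else c (Suc (\<sigma> v)))" for v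
    have f_label: "f v \<in> L (Suc (\<sigma> v)) (f' v)" if v: "v \<in> V \<union> Y" for v
    proof (cases "v \<in> V")
      case True
      then show ?thesis using b_label f'_V unfolding f_def by simp
    next
      case False
      then show ?thesis using c(1) d_Y n[OF v] v unfolding f_def by force
    qed
    have f'_in: "f' v \<in> W" if "v \<in> V \<union> Y" for v using f'_W that by blast
    have lab: "L (Suc (\<sigma> v)) (f' v) \<in> ?P (Suc (\<sigma> v))" if "v \<in> V \<union> Y" for v
      using L_in n f'_in that by blast
    have eq_V: "f' u = f' v \<longleftrightarrow> f u = f v" if u: "u \<in> V" and v: "v \<in> V \<union> Y" and eq: "\<sigma> v = \<sigma> u" for u v
    proof
      assume "f' u = f' v"
      then have "L (Suc (\<sigma> v)) (f' v) = {a u}" using b_label[OF u] f'_V u eq by simp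
      then show "f u = f v" using f_label[OF v] u unfolding f_def by simp
    next
      assume "f u = f v"
      then have "a u \<in> L (Suc (\<sigma> v)) (f' v)" using f_label[OF v] u unfolding f_def by simp
      moreover have "{a u} \<in> ?P (Suc (\<sigma> v))" using M.singleton_level V(2) u eq by (metis image_subset_iff)
      ultimately have "L (Suc (\<sigma> v)) (f' v) = {a u}" using unique[OF lab[OF v]] by blast
      then show "f' u = f' v" using b_unique[OF u f'_in[OF v]] f'_V u eq by simp
    qed
    have equality: "f' u = f' v \<longleftrightarrow> f u = f v"
      if u: "u \<in> V \<union> Y" and v: "v \<in> V \<union> Y" and eq: "\<sigma> v = \<sigma> u" for u v
    proof (cases "u \<in> V \<or> v \<in> V")
      case True
      then show ?thesis using eq_V[of u v] eq_V[of v u] u v eq by metis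
    next
      case False
      then have "u = v" using u v eq Y(2) by (auto simp: inj_on_def)
      then show ?thesis by simp
    qed
    have membership: "F (f' u) (f' v) \<longleftrightarrow> E (f u) (f v)"
      if u: "u \<in> V \<union> Y" and v: "v \<in> V \<union> Y" and lv: "\<sigma> v = Suc (\<sigma> u)" for u v
    proof -
      let ?t = "L (Suc (\<sigma> u)) (f' u)"
      have "fits (L (Suc (\<sigma> u))) (L (Suc (\<sigma> v)) (f' v)) (f' v)"
        using fits[of "Suc (\<sigma> u)" "f' v"] n[OF v] f'_in[OF v] lv by simp
      then have hit: "F (f' u) (f' v) \<Longrightarrow> ?t \<inter> M.elts (f v) \<noteq> {}"
        and miss: "\<not> F (f' u) (f' v) \<Longrightarrow> \<not> ?t \<subseteq> M.elts (f v)"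
        using f'_in[OF u] f_label[OF v] unfolding fits_def by blast+
      have t: "f u \<in> ?t" "?t \<subseteq> U" using f_label[OF u] cells lab[OF u] by blast+
      consider "u \<in> V" | "v \<in> V" | "u \<in> Y" "v \<in> Y" "u \<notin> V" "v \<notin> V" using u v by blast
      then show ?thesis
      proof cases
        case 1
        then have tu: "?t = {f u}" using b_label f'_V unfolding f_def by simp
        show ?thesis using hit miss t unfolding tu M.elts_def by auto
      next
        case 2
        have same: "E x (f v) \<longleftrightarrow> E (f u) (f v)" if "x \<in> ?t" for x
          using M.level_decides[OF 2 lv lab[OF u] that t(1)] 2 unfolding f_def by simp
        show ?thesis
        proof (cases "F (f' u) (f' v)")
          case True
          then obtain x where "x \<in> ?t" "E x (f v)" using hit unfolding M.elts_def by blast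
          then show ?thesis using same True by blast
        next
          case False
          then obtain x where "x \<in> ?t" "\<not> E x (f v)" using miss t(2) unfolding M.elts_def by blast
          then show ?thesis using same False by blast
        qed
      next
        case 3
        have "Suc (\<sigma> u) < n" using n[OF v] lv by simp
        then have "F (d (Suc (\<sigma> u))) (d (Suc (\<sigma> v))) \<longleftrightarrow> E (c (Suc (\<sigma> u))) (c (Suc (\<sigma> v)))"
          using c(2) lv by simp
        then show ?thesis using d_Y 3 unfolding f_def by simp
      qed
    qed
    have "f v \<in> U" if "v \<in> V \<union> Y" for v using f_label[OF that] cells(2)[OF lab[OF that]] by blast
    then have "f ` (V \<union> Y) \<subseteq> U" by blast
    moreover have "\<forall>v\<in>V. f v = a v" unfolding f_def by simp
    moreover have "same_atoms \<sigma> (V \<union> Y) F f' E f"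
      unfolding same_atoms_def using equality membership by simp
    ultimately show ?thesis by blast
  qed
  then show ?thesis using b_W by (intro exI[of _ b]) blast
qed

end

section \<open>Models of NF\<close>

lemma sat_Foralls:
  "sat U E e (foldr Forall xs p) \<longleftrightarrow>
     (\<forall>e'. (\<forall>v. v \<notin> set xs \<longrightarrow> e' v = e v) \<longrightarrow> e' ` set xs \<subseteq> U \<longrightarrow> sat U E e' p)"
proof (induction xs arbitrary: e)
  case Nil
  have "e' = e" if "\<forall>v. e' v = e v" for e' using that by blast
  then show ?case by auto
next
  case (Cons x xs)
  show ?case
  proof
    assume l: "sat U E e (foldr Forall (x # xs) p)"
    show "\<forall>e'. (\<forall>v. v \<notin> set (x # xs) \<longrightarrow> e' v = e v) \<longrightarrow> e' ` set (x # xs) \<subseteq> U \<longrightarrow> sat U E e' p"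
    proof (intro allI impI)
      fix e' assume e': "\<forall>v. v \<notin> set (x # xs) \<longrightarrow> e' v = e v" "e' ` set (x # xs) \<subseteq> U"
      then have "sat U E (e(x := e' x)) (foldr Forall xs p)" using l by simp
      then show "sat U E e' p" using e' unfolding Cons by auto
    qed
  next
    assume r: "\<forall>e'. (\<forall>v. v \<notin> set (x # xs) \<longrightarrow> e' v = e v) \<longrightarrow> e' ` set (x # xs) \<subseteq> U \<longrightarrow> sat U E e' p"
    have "sat U E (e(x := d)) (foldr Forall xs p)" if "d \<in> U" for d
      unfolding Cons
    proof (intro allI impI)
      fix e' assume e': "\<forall>v. v \<notin> set xs \<longrightarrow> e' v = (e(x := d)) v" "e' ` set xs \<subseteq> U"
      have "e' x \<in> U" using e' that by (cases "x \<in> set xs") auto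
      then show "sat U E e' p" using r e' by auto
    qed
    then show "sat U E e (foldr Forall (x # xs) p)" by simp
  qed
qed

lemma sat_Existss:
  "sat U E e (Existss ys p) \<longleftrightarrow> sat U E e (Neg (foldr Forall ys (Neg p)))"
  by (induction ys arbitrary: e) auto

lemma FV_Foralls: "FV (foldr Forall xs p) = FV p - set xs"
  by (induction xs) auto

lemma FV_Existss: "FV (Existss xs p) = FV p - set xs"
  by (induction xs) auto

lemma sentence_NF: "p \<in> NF \<Longrightarrow> sentence p"
  unfolding NF_def sentence_def
  by (auto simp: Extensionality_def Comprehension_def FV_Foralls)

lemma comprehension:
  assumes "models U E NF" and e: "range e \<subseteq> U"
    and "stratified p" "distinct (x # y # zs)" "FV p \<subseteq> insert x (set zs)"
  shows "\<exists>c\<in>U. \<forall>d\<in>U. E d c \<longleftrightarrow> sat U E (e(x := d)) p"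
proof -
  have "Comprehension zs y x p \<in> NF" using assms(3-5) unfolding NF_def by blast
  then have "sat U E e (Comprehension zs y x p)" using assms(1,2) unfolding models_def by blast
  then have "sat U E e (Exists y (Forall x (Iff (Mem x y) p)))"
    unfolding Comprehension_def sat_Foralls using e by blast
  then obtain c where c: "c \<in> U" "\<forall>d\<in>U. E d c \<longleftrightarrow> sat U E (e(y := c, x := d)) p"
    using assms(4) by auto
  have "sat U E (e(y := c, x := d)) p \<longleftrightarrow> sat U E (e(x := d)) p" for d
    by (rule sat_cong) (use assms(4,5) in auto)
  then show ?thesis using c by blast
qed

text \<open>In the comprehension instances below, \<open>0\<close> is the element variable, \<open>1\<close> the set being formed, \<open>2\<close> and
  \<open>3\<close> are parameters, and \<open>4\<close> is a bound variable ranging over elements of the element.\<close>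

lemma nf_structure_if_models:
  assumes M: "models U E NF"
  shows "nf_structure U E"
proof -
  interpret membership U E .
  have ne: "U \<noteq> {}" using M unfolding models_def by blast
  have mem_U: "x \<in> elts y \<longleftrightarrow> x \<in> U \<and> E x y" for x y by (auto simp: elts_def)
  have set: "is_set {x \<in> U. sat U E ((\<lambda>_. u)(3 := v, 0 := x)) p}"
    if "u \<in> U" "v \<in> U" "stratified p" "FV p \<subseteq> {0, 2, 3}" for u v p
  proof -
    have "\<exists>c\<in>U. \<forall>d\<in>U. E d c \<longleftrightarrow> sat U E ((\<lambda>_. u)(3 := v, 0 := d)) p"
      by (rule comprehension[OF M _ that(3), where y = 1 and zs = "[2, 3]"]) (use that in auto)
    then obtain c where "c \<in> U" "elts c = {x \<in> U. sat U E ((\<lambda>_. u)(3 := v, 0 := x)) p}"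
      unfolding elts_def by blast
    then show ?thesis unfolding is_set_def by blast
  qed
  have strat: "stratified p" if "stratification (\<lambda>v. if v = 0 then i else if v = 4 then j else k) p" for p i j k
    using that unfolding stratified_def by blast
  show ?thesis
  proof
    show "U \<noteq> {}" by (rule ne)
    show "inj_on elts U"
    proof (rule inj_onI)
      fix x y assume xy: "x \<in> U" "y \<in> U" "elts x = elts y"
      have "sat U E (\<lambda>_. x) Extensionality" using M xy(1) unfolding models_def NF_def by auto
      then have "x = y \<longleftrightarrow> (\<forall>z\<in>U. E z x \<longleftrightarrow> E z y)"
        using xy(1,2) unfolding Extensionality_def by auto
      then show "x = y" using xy(3) by (auto simp: mem_U set_eq_iff)
    qed
    show "is_set {u}" if u: "u \<in> U" for u
    proof -
      have "is_set {x \<in> U. sat U E ((\<lambda>_. u)(3 := u, 0 := x)) (Eq 0 2)}"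
        by (rule set[OF u u strat[of 0 0 0]]) (auto simp: stratification_def)
      moreover have "{x \<in> U. sat U E ((\<lambda>_. u)(3 := u, 0 := x)) (Eq 0 2)} = {u}" using u by auto
      ultimately show ?thesis by simp
    qed
    show "is_set (C \<union> D)" if "is_set C" "is_set D" for C D
    proof -
      obtain u v where uv: "u \<in> U" "v \<in> U" "C = elts u" "D = elts v"
        using \<open>is_set C\<close> \<open>is_set D\<close> unfolding is_set_def by blast
      let ?p = "Imp (Neg (Mem 0 2)) (Mem 0 3)"
      have "is_set {x \<in> U. sat U E ((\<lambda>_. u)(3 := v, 0 := x)) ?p}"
        by (rule set[OF uv(1,2) strat[of 0 0 1]]) (auto simp: stratification_def)
      moreover have "{x \<in> U. sat U E ((\<lambda>_. u)(3 := v, 0 := x)) ?p} = C \<union> D" using uv by (auto simp: mem_U)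
      ultimately show ?thesis by simp
    qed
    fix D assume "is_set D"
    then obtain u where u: "u \<in> U" "D = elts u" unfolding is_set_def by blast
    show "is_set (U - D)"
    proof -
      have "is_set {x \<in> U. sat U E ((\<lambda>_. u)(3 := u, 0 := x)) (Neg (Mem 0 2))}"
        by (rule set[OF u(1) u(1) strat[of 0 0 1]]) (auto simp: stratification_def)
      moreover have "{x \<in> U. sat U E ((\<lambda>_. u)(3 := u, 0 := x)) (Neg (Mem 0 2))} = U - D" using u by (auto simp: mem_U)
      ultimately show ?thesis by simp
    qed
    show "is_set {y \<in> U. elts y \<subseteq> D}"
    proof -
      let ?p = "Forall 4 (Imp (Mem 4 0) (Mem 4 2))"
      have "is_set {x \<in> U. sat U E ((\<lambda>_. u)(3 := u, 0 := x)) ?p}"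
        by (rule set[OF u(1) u(1) strat[of 1 0 1]]) (auto simp: stratification_def)
      moreover have "{x \<in> U. sat U E ((\<lambda>_. u)(3 := u, 0 := x)) ?p} = {y \<in> U. elts y \<subseteq> D}"
        using u by (auto simp: mem_U)
      ultimately show ?thesis by simp
    qed
    show "is_set {y \<in> U. D \<subseteq> elts y}"
    proof -
      let ?p = "Forall 4 (Imp (Mem 4 2) (Mem 4 0))"
      have "is_set {x \<in> U. sat U E ((\<lambda>_. u)(3 := u, 0 := x)) ?p}"
        by (rule set[OF u(1) u(1) strat[of 1 0 1]]) (auto simp: stratification_def)
      moreover have "{x \<in> U. sat U E ((\<lambda>_. u)(3 := u, 0 := x)) ?p} = {y \<in> U. D \<subseteq> elts y}"
        using u by (auto simp: mem_U)
      ultimately show ?thesis by simp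
    qed
  qed
qed

lemma sat_quantifier_free_cong:
  "quantifier_free p \<Longrightarrow> stratification \<sigma> p \<Longrightarrow> same_atoms \<sigma> A E e F f \<Longrightarrow> FV p \<subseteq> A \<Longrightarrow>
    sat U E e p \<longleftrightarrow> sat W F f p"
  by (induction p) (auto simp: stratification_def same_atoms_def)

lemma subformulas_prefix:
  "subformulas p \<subseteq> subformulas (Foralls xs p)" "subformulas p \<subseteq> subformulas (Existss ys p)"
  by (induction xs) (auto, induction ys, auto)

lemma stratification_subset:
  "stratification \<sigma> q \<Longrightarrow> subformulas p \<subseteq> subformulas q \<Longrightarrow> stratification \<sigma> p"
  unfolding stratification_def by blast

text \<open>A variable that occurs both in \<open>xs\<close> and in \<open>ys\<close> is bound by the inner quantifier, so only the
  variables in \<open>V\<close> count as universal.\<close>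

lemma counterexample_transfers:
  assumes M: "nf_structure U E" and N: "nf_structure W F"
    and qf: "quantifier_free \<theta>" and strat: "stratification \<sigma> \<theta>" and dist: "distinct (map \<sigma> ys)"
    and fv: "FV \<theta> \<subseteq> set xs \<union> set ys"
    and e: "range e \<subseteq> U" "\<not> sat U E e (Foralls xs (Existss ys \<theta>))" and e': "range e' \<subseteq> W"
  shows "\<not> sat W F e' (Foralls xs (Existss ys \<theta>))"
proof -
  interpret nf_pair U E W F using M N by (simp add: nf_pair_def)
  obtain a where a: "\<forall>v. v \<notin> set xs \<longrightarrow> a v = e v" "a ` set xs \<subseteq> U" "\<not> sat U E a (Existss ys \<theta>)"
    using e(2) unfolding sat_Foralls by blast
  have a_U: "a v \<in> U" for v using a(1,2) e(1) by (cases "v \<in> set xs") auto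
  have fail: "\<not> sat U E f \<theta>" if "\<forall>v. v \<notin> set ys \<longrightarrow> f v = a v" "f ` set ys \<subseteq> U" for f
    using a(3) that unfolding sat_Existss sat.simps sat_Foralls by blast
  define V where "V = FV \<theta> - set ys"
  have inj: "inj_on \<sigma> (set ys)" using dist by (simp add: distinct_map)
  have V: "finite V" "V \<subseteq> set xs" using finite_FV fv unfolding V_def by auto
  have aV: "a ` V \<subseteq> U" using a_U by blast
  have disj: "V \<inter> set ys = {}" unfolding V_def by blast
  obtain b where b: "b ` V \<subseteq> W" "\<forall>f'. f' ` (V \<union> set ys) \<subseteq> W \<longrightarrow> (\<forall>v\<in>V. f' v = b v) \<longrightarrow>
      (\<exists>f. f ` (V \<union> set ys) \<subseteq> U \<and> (\<forall>v\<in>V. f v = a v) \<and> same_atoms \<sigma> (V \<union> set ys) F f' E f)"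
    using transfer_assignment[OF V(1) aV finite_set inj disj] by (elim exE conjE) (rule that)
  \<comment> \<open>Outside \<open>V\<close> the values do not affect \<open>\<theta>\<close>; they only have to agree with \<open>e'\<close> off \<open>xs\<close>.\<close>
  define b' where "b' v = (if v \<in> V then b v else e' v)" for v
  have b'_W: "b' v \<in> W" for v using b(1) e' unfolding b'_def by auto
  have "\<not> sat W F f' \<theta>" if f': "\<forall>v. v \<notin> set ys \<longrightarrow> f' v = b' v" "f' ` set ys \<subseteq> W" for f'
  proof -
    have "\<forall>v\<in>V. f' v = b v" using f'(1) unfolding b'_def V_def by auto
    moreover have "f' v \<in> W" for v using f' b'_W by (cases "v \<in> set ys") auto
    then have "f' ` (V \<union> set ys) \<subseteq> W" by blast
    ultimately obtain f where f: "f ` (V \<union> set ys) \<subseteq> U" "\<forall>v\<in>V. f v = a v"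
      "same_atoms \<sigma> (V \<union> set ys) F f' E f"
      using b(2)[rule_format, of f'] by auto
    have sub: "FV \<theta> \<subseteq> V \<union> set ys" unfolding V_def by blast
    define g where "g v = (if v \<in> set ys then f v else a v)" for v
    have "\<not> sat U E g \<theta>" using fail[of g] f(1) unfolding g_def by auto
    moreover have "sat U E g \<theta> \<longleftrightarrow> sat U E f \<theta>"
      by (rule sat_cong) (use f(2) sub in \<open>auto simp: g_def\<close>)
    moreover have "sat W F f' \<theta> \<longleftrightarrow> sat U E f \<theta>"
      using qf strat f(3) sub by (rule sat_quantifier_free_cong)
    ultimately show ?thesis by simp
  qed
  then have "\<not> sat W F b' (Existss ys \<theta>)" unfolding sat_Existss sat.simps sat_Foralls by blast
  moreover have "\<forall>v. v \<notin> set xs \<longrightarrow> b' v = e' v" using V(2) unfolding b'_def by auto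
  moreover have "b' ` set xs \<subseteq> W" using b'_W by auto
  ultimately show ?thesis unfolding sat_Foralls by blast
qed

theorem corollary4p21:
  fixes xs ys :: "var list" and \<theta> \<phi> :: fm and \<sigma> :: "var \<Rightarrow> nat"
  assumes "\<phi> = Foralls xs (Existss ys \<theta>)"
    and "quantifier_free \<theta>"
    and "sentence \<phi>"
    and "stratification \<sigma> \<phi>"
    and "distinct (map \<sigma> ys)"
  shows "NF \<turnstile> \<phi> \<or> NF \<turnstile> Neg \<phi>"
proof (rule ccontr)
  assume "\<not> ?thesis"
  then have not: "\<not> NF \<turnstile> \<phi>" "\<not> NF \<turnstile> Neg \<phi>" by auto
  have "sentence (Neg \<phi>)" using assms(3) by (simp add: sentence_def)
  obtain U :: "nat set" and E where M: "models U E (insert (Neg \<phi>) NF)"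
    using countermodel[OF sentence_NF assms(3) not(1)] .
  obtain W :: "nat set" and F where N: "models W F (insert (Neg (Neg \<phi>)) NF)"
    using countermodel[OF sentence_NF \<open>sentence (Neg \<phi>)\<close> not(2)] .
  obtain u w where uw: "u \<in> U" "w \<in> W" using M N unfolding models_def by blast
  then have false: "\<not> sat U E (\<lambda>_. u) \<phi>" and true: "sat W F (\<lambda>_. w) \<phi>"
    using M N unfolding models_def by auto
  have "models U E NF" "models W F NF" using M N unfolding models_def by auto
  then have str: "nf_structure U E" "nf_structure W F" by (auto intro: nf_structure_if_models)
  have strat: "stratification \<sigma> \<theta>"
    using assms(4) unfolding assms(1)
    by (rule stratification_subset) (rule order_trans[OF subformulas_prefix(2,1)])
  have "FV \<theta> \<subseteq> set xs \<union> set ys"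
    using assms(1,3) by (auto simp: sentence_def FV_Foralls FV_Existss)
  then show False
    using counterexample_transfers[OF str assms(2) strat assms(5) _ _ false[unfolded assms(1)], of "\<lambda>_. w"]
      true uw unfolding assms(1) by auto
qed

end
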